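(* Let $n\ge2$, $d\ge 2$ an even integer, and $f$ a form of degree $d$ in $n$ variables. Then $H_f(x)$ is positive definite for all $x\ne 0$ if and only if there exist a real number $c>0$ and a nonnegative integer $r$ such that the form $f(x)-c\left(\sum_{i=1}^n x_i^2\right)^{d/2}$ is $r$-sos-convex.
   Context: $H_f(x)$ is the Hessian matrix of $f$ at $x$. A polynomial is a sum of squares if it equals $\sum_i q_i^2$ for polynomials $q_i$. For a nonnegative integer $r$, a polynomial $g$ in $x=(x_1,\dots,x_n)$ is called $r$-sos-convex if the polynomial $y^TH_g(x)y\cdot\left(\sum_{i=1}^n x_i^2\right)^r$ in the variables $(x,y)\in\mathbb{R}^{2n}$ is a sum of squares. *)

theory Defs
  imports "HOL-Analysis.Analysis"
begin

definition monomial_fun :: "('n::finite \<Rightarrow> nat) \<Rightarrow> real^'n \<Rightarrow> real" where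
  "monomial_fun \<alpha> x = (\<Prod>i\<in>UNIV. (x $ i) ^ (\<alpha> i))"

text \<open>A form (homogeneous polynomial) of degree d in the variables x.
  Over the reals polynomials and polynomial functions are identified.\<close>
definition is_form :: "nat \<Rightarrow> (real^'n::finite \<Rightarrow> real) \<Rightarrow> bool" where
  "is_form d f \<longleftrightarrow> (\<exists>A c. finite A \<and> (\<forall>\<alpha>\<in>A. (\<Sum>i\<in>UNIV. \<alpha> i) = d) \<and>
        (\<forall>x. f x = (\<Sum>\<alpha>\<in>A. c \<alpha> * monomial_fun \<alpha> x)))"

definition is_poly2 :: "(real^'n::finite \<Rightarrow> real^'n \<Rightarrow> real) \<Rightarrow> bool" where
  "is_poly2 p \<longleftrightarrow> (\<exists>A c. finite A \<and>
        (\<forall>x y. p x y = (\<Sum>(\<alpha>,\<beta>)\<in>A. c \<alpha> \<beta> * monomial_fun \<alpha> x * monomial_fun \<beta> y)))"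

definition is_sos2 :: "(real^'n::finite \<Rightarrow> real^'n \<Rightarrow> real) \<Rightarrow> bool" where
  "is_sos2 p \<longleftrightarrow> (\<exists>qs. (\<forall>q\<in>set qs. is_poly2 q) \<and>
        (\<forall>x y. p x y = (\<Sum>q\<leftarrow>qs. (q x y)\<^sup>2)))"

definition partial :: "'n::finite \<Rightarrow> (real^'n \<Rightarrow> real) \<Rightarrow> real^'n \<Rightarrow> real" where
  "partial i g x = deriv (\<lambda>t. g (x + t *\<^sub>R axis i 1)) 0"

definition hessian :: "(real^'n::finite \<Rightarrow> real) \<Rightarrow> real^'n \<Rightarrow> real^'n^'n" where
  "hessian f x = (\<chi> i j. partial i (partial j f) x)"

definition pos_def :: "real^'n^'n::finite \<Rightarrow> bool" where
  "pos_def M \<longleftrightarrow> (\<forall>y. y \<noteq> 0 \<longrightarrow> y \<bullet> (M *v y) > 0)"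

definition r_sos_convex :: "nat \<Rightarrow> (real^'n::finite \<Rightarrow> real) \<Rightarrow> bool" where
  "r_sos_convex r g \<longleftrightarrow>
     is_sos2 (\<lambda>x y. (y \<bullet> (hessian g x *v y)) * (\<Sum>i\<in>UNIV. (x $ i)\<^sup>2) ^ r)"

end

theory Submission
  imports Defs "HOL-Probability.Distributions"
begin

text \<open>
  Compactness of the unit sphere yields a \<open>c > 0\<close> for which the biform
  \<open>y\<^sup>T H\<^sub>g(x) y\<close> of \<open>g = f - c |x|\<^sup>d\<close> is still positive. A positive biform \<open>y\<^sup>T P(x) y\<close>
  with \<open>P\<close> of even degree \<open>m\<close> becomes a sum of squares after multiplication by a power of
  \<open>|x|\<^sup>2\<close> by a matrix version of Reznick's argument. With \<open>u\<close> a standard Gaussian vector, the operator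
  \<open>Q \<mapsto> E(\<langle>x, u\<rangle>\<^sup>K Q(u))\<close> maps forms of degree \<open>m\<close> to \<open>|x|\<close> to the power \<open>K - m\<close> times forms of
  degree \<open>m\<close> and, suitably normalised, tends to the identity as \<open>K \<rightarrow> \<infinity>\<close>. So \<open>P\<close> has preimages
  \<open>Q\<^sub>K \<rightarrow> P\<close>. For large even \<open>K\<close> the matrix \<open>Q\<^sub>K(u)\<close> is positive semidefinite for every \<open>u\<close>,
  and then the expectation of \<open>\<langle>x, u\<rangle>\<^sup>K y\<^sup>T Q\<^sub>K(u) y\<close> is a sum of squares.
\<close>

section \<open>Monomials and polynomial functions\<close>

lemma monomial_fun_Suc:
  "monomial_fun (\<alpha>(i := Suc (\<alpha> i))) u = u $ i * monomial_fun \<alpha> u"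
proof -
  have "monomial_fun (\<alpha>(i := Suc (\<alpha> i))) u
      = (u $ i) ^ Suc (\<alpha> i) * (\<Prod>j\<in>UNIV - {i}. (u $ j) ^ (\<alpha> j))"
    unfolding monomial_fun_def by (subst prod.remove[of _ i]) (auto intro!: prod.cong)
  also have "\<dots> = u $ i * ((u $ i) ^ \<alpha> i * (\<Prod>j\<in>UNIV - {i}. (u $ j) ^ (\<alpha> j)))"
    by simp
  also have "(u $ i) ^ \<alpha> i * (\<Prod>j\<in>UNIV - {i}. (u $ j) ^ (\<alpha> j)) = monomial_fun \<alpha> u"
    unfolding monomial_fun_def by (subst (2) prod.remove[of _ i]) auto
  finally show ?thesis .
qed

lemma monomial_fun_pred:
  assumes "0 < \<alpha> i"
  shows "u $ i * monomial_fun (\<alpha>(i := \<alpha> i - 1)) u = monomial_fun \<alpha> u"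
  using monomial_fun_Suc[of "\<alpha>(i := \<alpha> i - 1)" i u] assms by simp

lemma monomial_fun_zero [simp]: "monomial_fun (\<lambda>_. 0) u = 1"
  by (simp add: monomial_fun_def)

lemma monomial_fun_scaleR:
  "monomial_fun \<alpha> (t *\<^sub>R u) = t ^ sum \<alpha> UNIV * monomial_fun \<alpha> u"
  by (simp add: monomial_fun_def power_mult_distrib prod.distrib power_sum)

lemma sum_fun_upd_Suc:
  fixes \<alpha> :: "'n::finite \<Rightarrow> nat"
  shows "sum (\<alpha>(i := Suc (\<alpha> i))) UNIV = Suc (sum \<alpha> UNIV)"
  by (subst (1 2) sum.remove[of _ i]) (auto intro!: sum.cong)

lemma real_polynomial_nth [intro]: "real_polynomial_function (\<lambda>u. (u::real^'n) $ i)"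
  by (rule real_polynomial_function.intros(1)) (rule bounded_linear_vec_nth)

lemma real_polynomial_monomial_fun [intro]:
  "real_polynomial_function (monomial_fun \<alpha> :: real^'n \<Rightarrow> real)"
proof -
  have "real_polynomial_function (\<lambda>u::real^'n. \<Prod>i\<in>UNIV. (u $ i) ^ (\<alpha> i))"
    by (intro real_polynomial_function_prod real_polynomial_function_power) auto
  then show ?thesis unfolding monomial_fun_def .
qed

lemma real_polynomial_inner_right [intro]: "real_polynomial_function (\<lambda>u::real^'n. x \<bullet> u)"
  by (rule real_polynomial_function.intros(1)) (rule bounded_linear_inner_right)

section \<open>The standard Gaussian functional on polynomials\<close>

definition std_normal :: "real measure" where
  "std_normal = density lborel (\<lambda>t. ennreal (std_normal_density t))"

definition std_normal_moment :: "nat \<Rightarrow> real" where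
  "std_normal_moment k = (\<integral>t. t ^ k \<partial>std_normal)"

lemma prob_space_std_normal: "prob_space std_normal"
  unfolding std_normal_def by (rule prob_space_normal_density) simp

lemma integrable_std_normal_power: "integrable std_normal (\<lambda>t. t ^ k)"
  unfolding std_normal_def
  by (subst integrable_density) (auto intro: integrable_std_normal_moment)

lemma std_normal_moment_eq:
  "std_normal_moment k = (\<integral>t. std_normal_density t * t ^ k \<partial>lborel)"
  unfolding std_normal_moment_def std_normal_def
  by (subst integral_density) auto

lemma std_normal_moment_double:
  "std_normal_moment (2 * k) = fact (2 * k) / (2 ^ k * fact k)"
  unfolding std_normal_moment_eq by (rule integral_std_normal_moment_even)

lemma std_normal_moment_double_Suc: "std_normal_moment (2 * k + 1) = 0"
  unfolding std_normal_moment_eq by (rule integral_std_normal_moment_odd)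

lemma std_normal_moment_0: "std_normal_moment 0 = 1"
  using std_normal_moment_double[of 0] by simp

text \<open>Integration by parts in one variable, \<open>E(t * t^k) = k * E(t^(k-1))\<close>, read
  off from the closed formulas for even and odd moments. At \<open>k = 0\<close> the truncated
  \<open>k - 1\<close> is harmless because the factor \<open>real k\<close> vanishes.\<close>

lemma std_normal_moment_Suc:
  "std_normal_moment (Suc k) = real k * std_normal_moment (k - 1)"
proof (cases "even k")
  case True
  then obtain j where k: "k = 2 * j" by blast
  have "std_normal_moment (Suc k) = 0"
    using std_normal_moment_double_Suc[of j] k by simp
  moreover have "real k * std_normal_moment (k - 1) = 0"
  proof (cases j)
    case (Suc l)
    then show ?thesis using std_normal_moment_double_Suc[of l] k by simp
  qed (simp add: k)
  ultimately show ?thesis by simp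
next
  case False
  then obtain j where k: "k = 2 * j + 1" by (blast elim: oddE)
  have "std_normal_moment (2 * Suc j) = real (2 * j + 1) * std_normal_moment (2 * j)"
    unfolding std_normal_moment_double
    by (simp add: divide_simps)
  then show ?thesis using k by simp
qed

text \<open>Expectation under the standard Gaussian on \<open>real^'n\<close>. The product measure
  lives on functions, so \<open>vec_lambda\<close> transports its points; independence of the
  coordinates makes monomials factor.\<close>

definition gauss :: "(real^'n::finite \<Rightarrow> real) \<Rightarrow> real" where
  "gauss h = (\<integral>\<omega>. h (vec_lambda \<omega>) \<partial>(\<Pi>\<^sub>M i\<in>UNIV. std_normal))"

lemma product_sigma_finite_std_normal: "product_sigma_finite (\<lambda>_. std_normal)"
  by (intro product_sigma_finite.intro prob_space_imp_sigma_finite prob_space_std_normal)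

lemma integrable_gauss_monomial:
  "integrable (\<Pi>\<^sub>M i\<in>UNIV. std_normal) (\<lambda>\<omega>. monomial_fun \<alpha> (vec_lambda \<omega>))"
  unfolding monomial_fun_def
  using product_sigma_finite.product_integrable_prod[OF product_sigma_finite_std_normal finite,
      of UNIV "\<lambda>i t. t ^ \<alpha> i"] integrable_std_normal_power
  by simp

lemma gauss_monomial: "gauss (monomial_fun \<alpha>) = (\<Prod>i\<in>UNIV. std_normal_moment (\<alpha> i))"
  unfolding gauss_def monomial_fun_def std_normal_moment_def
  using product_sigma_finite.product_integral_prod[OF product_sigma_finite_std_normal finite,
      of UNIV "\<lambda>i t. t ^ \<alpha> i"] integrable_std_normal_power
  by simp

text \<open>Integrability does not pass to products, so the induction over polynomial functions
  proves more: multiplication by \<open>h\<close> preserves the class of all \<open>g\<close> whose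
  product with every monomial is integrable.\<close>

lemma integrable_gauss:
  fixes h :: "real^'n \<Rightarrow> real"
  assumes "real_polynomial_function h"
  shows "integrable (\<Pi>\<^sub>M i\<in>UNIV. std_normal) (\<lambda>\<omega>. h (vec_lambda \<omega>))"
proof -
  let ?I = "\<lambda>h. integrable (\<Pi>\<^sub>M i\<in>UNIV. std_normal) (\<lambda>\<omega>. h (vec_lambda \<omega>))"
  have "(\<forall>\<alpha>. ?I (\<lambda>u. g u * monomial_fun \<alpha> u)) \<Longrightarrow>
      (\<forall>\<alpha>. ?I (\<lambda>u. h u * g u * monomial_fun \<alpha> u))" for g
    using assms
  proof (induction arbitrary: g)
    case (linear f)
    show ?case
    proof
      fix \<alpha>
      \<comment> \<open>A linear functional is a combination of coordinates, and each coordinate is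
        absorbed into the monomial.\<close>
      have f: "f u = (\<Sum>i\<in>UNIV. f (axis i 1) * u $ i)" for u
      proof -
        have "f u = f (\<Sum>i\<in>UNIV. u $ i *\<^sub>R axis i 1)"
          by (subst basis_expansion[of u, symmetric]) (simp add: scalar_mult_eq_scaleR)
        also have "\<dots> = (\<Sum>i\<in>UNIV. u $ i *\<^sub>R f (axis i 1))"
          using linear.hyps by (simp add: linear_sum bounded_linear.linear linear_scale)
        finally show ?thesis by (simp add: mult.commute)
      qed
      have "f u * g u * monomial_fun \<alpha> u
          = (\<Sum>i\<in>UNIV. f (axis i 1) * (g u * monomial_fun (\<alpha>(i := Suc (\<alpha> i))) u))" for u
        by (subst f) (simp add: monomial_fun_Suc sum_distrib_left sum_distrib_right mult_ac)
      then show "?I (\<lambda>u. f u * g u * monomial_fun \<alpha> u)"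
        using linear.prems by (auto intro!: integrable_sum integrable_mult_right)
    qed
  next
    case (const c)
    then show ?case by (simp add: mult.assoc integrable_mult_right)
  next
    case (add f1 f2)
    then show ?case by (simp add: distrib_right)
  next
    case (mult f1 f2)
    have "\<forall>\<alpha>. ?I (\<lambda>u. f1 u * (f2 u * g u) * monomial_fun \<alpha> u)"
      by (rule mult.IH(1)) (rule mult.IH(2)[OF mult.prems])
    then show ?case by (simp add: mult.assoc)
  qed
  from this[of "\<lambda>_. 1"] have "\<forall>\<alpha>. ?I (\<lambda>u. h u * 1 * monomial_fun \<alpha> u)"
    by (simp add: integrable_gauss_monomial)
  from spec[OF this, of "\<lambda>_. 0"] show ?thesis by (simp only: mult_1_right monomial_fun_zero)
qed

lemma gauss_nonneg: "(\<And>u. 0 \<le> h u) \<Longrightarrow> 0 \<le> gauss h"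
  unfolding gauss_def by (rule integral_nonneg_AE) simp

lemma gauss_add:
  "real_polynomial_function h \<Longrightarrow> real_polynomial_function k \<Longrightarrow>
    gauss (\<lambda>u. h u + k u) = gauss h + gauss k"
  unfolding gauss_def by (intro Bochner_Integration.integral_add integrable_gauss)

lemma gauss_cmult: "gauss (\<lambda>u. a * h u) = a * gauss h"
  unfolding gauss_def by simp

lemma gauss_sum:
  "(\<And>j. j \<in> J \<Longrightarrow> real_polynomial_function (h j)) \<Longrightarrow>
    gauss (\<lambda>u. \<Sum>j\<in>J. a j * h j u) = (\<Sum>j\<in>J. a j * gauss (h j))"
  unfolding gauss_def
  by (subst Bochner_Integration.integral_sum) (auto intro: integrable_gauss)

text \<open>Integration by parts in the \<open>i\<close>-th coordinate: the right-hand side is the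
  expectation of the \<open>i\<close>-th partial derivative of the monomial.\<close>

lemma gauss_mult_nth_monomial:
  "gauss (\<lambda>u. u $ i * monomial_fun \<alpha> u) = \<alpha> i * gauss (monomial_fun (\<alpha>(i := \<alpha> i - 1)))"
proof -
  let ?P = "\<Prod>j\<in>UNIV - {i}. std_normal_moment (\<alpha> j)"
  have "gauss (\<lambda>u. u $ i * monomial_fun \<alpha> u) = gauss (monomial_fun (\<alpha>(i := Suc (\<alpha> i))))"
    by (simp add: monomial_fun_Suc[abs_def] del: fun_upd_apply)
  also have "\<dots> = std_normal_moment (Suc (\<alpha> i)) * ?P"
    unfolding gauss_monomial by (subst prod.remove[of _ i]) auto
  also have "\<dots> = \<alpha> i * (std_normal_moment (\<alpha> i - 1) * ?P)"
    by (simp add: std_normal_moment_Suc)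
  also have "std_normal_moment (\<alpha> i - 1) * ?P = gauss (monomial_fun (\<alpha>(i := \<alpha> i - 1)))"
    unfolding gauss_monomial by (subst (2) prod.remove[of _ i]) auto
  finally show ?thesis .
qed

section \<open>Gaussian expectations weighted by a power of a linear form\<close>

definition gauss_power :: "nat \<Rightarrow> real^'n::finite \<Rightarrow> (real^'n \<Rightarrow> real) \<Rightarrow> real" where
  "gauss_power K x h = gauss (\<lambda>u. (x \<bullet> u) ^ K * h u)"

lemma gauss_power_sum:
  "(\<And>j. j \<in> J \<Longrightarrow> real_polynomial_function (h j)) \<Longrightarrow>
    gauss_power K x (\<lambda>u. \<Sum>j\<in>J. a j * h j u) = (\<Sum>j\<in>J. a j * gauss_power K x (h j))"
  unfolding gauss_power_def
  by (subst gauss_sum[symmetric])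
    (auto simp: sum_distrib_left mult.left_commute intro!: real_polynomial_function.intros(4))

lemma gauss_power_add:
  "real_polynomial_function h \<Longrightarrow> real_polynomial_function k \<Longrightarrow>
    gauss_power K x (\<lambda>u. h u + k u) = gauss_power K x h + gauss_power K x k"
  unfolding gauss_power_def
  by (subst gauss_add[symmetric])
    (auto simp: distrib_left intro!: real_polynomial_function.intros(4))

lemma gauss_power_cmult: "gauss_power K x (\<lambda>u. a * h u) = a * gauss_power K x h"
  unfolding gauss_power_def by (subst gauss_cmult[symmetric]) (simp add: mult_ac)

lemma gauss_power_Suc:
  assumes "real_polynomial_function h"
  shows "gauss_power (Suc K) x h = (\<Sum>j\<in>UNIV. x $ j * gauss_power K x (\<lambda>u. u $ j * h u))"
proof -
  have "gauss_power (Suc K) x h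
      = gauss_power K x (\<lambda>u. \<Sum>j\<in>UNIV. x $ j * (u $ j * h u))"
    unfolding gauss_power_def inner_vec_def
    by (simp add: sum_distrib_left sum_distrib_right mult_ac)
  also have "\<dots> = (\<Sum>j\<in>UNIV. x $ j * gauss_power K x (\<lambda>u. u $ j * h u))"
    using assms by (intro gauss_power_sum) auto
  finally show ?thesis .
qed

text \<open>Integration by parts for the product of \<open>(x \<bullet> u) ^ K\<close> and a
  monomial: the two summands are the two terms of the product rule. Induction on \<open>K\<close>
  splits off one factor \<open>x \<bullet> u\<close> and moves it into the monomial, so that only
  \<open>K = 0\<close> uses the moments.\<close>

lemma gauss_power_mult_nth_monomial:
  fixes x :: "real^'n"
  shows "gauss_power K x (\<lambda>u. u $ i * monomial_fun \<alpha> u)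
    = K * x $ i * gauss_power (K - 1) x (monomial_fun \<alpha>)
      + \<alpha> i * gauss_power K x (monomial_fun (\<alpha>(i := \<alpha> i - 1)))"
proof (induction K arbitrary: \<alpha>)
  case 0
  show ?case by (simp add: gauss_power_def gauss_mult_nth_monomial fun_upd_def)
next
  case (Suc K)
  let ?G = "\<lambda>K. gauss_power K x" and ?p = "\<alpha>(i := \<alpha> i - 1)"
  let ?s = "\<lambda>j. \<alpha>(j := Suc (\<alpha> j))"
  \<comment> \<open>The product rule for the \<open>i\<close>-th derivative of \<open>u $ j\<close>
    times the monomial with exponent \<open>\<alpha>\<close>.\<close>
  have deriv: "?s j i * ?G K (monomial_fun ((?s j)(i := ?s j i - 1)))
      = (if j = i then ?G K (monomial_fun \<alpha>) else 0)
        + \<alpha> i * ?G K (\<lambda>u. u $ j * monomial_fun ?p u)" for j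
  proof (cases "j = i")
    case True
    have "\<alpha> i * ?G K (\<lambda>u. u $ i * monomial_fun ?p u) = \<alpha> i * ?G K (monomial_fun \<alpha>)"
      by (cases "\<alpha> i = 0") (simp_all add: monomial_fun_pred[unfolded One_nat_def])
    then show ?thesis using True by (auto simp: distrib_right)
  next
    case False
    have upd: "(?s j)(i := ?s j i - 1) = ?p(j := Suc (?p j))" using False by auto
    have "monomial_fun ((?s j)(i := ?s j i - 1)) = (\<lambda>u. u $ j * monomial_fun ?p u)"
      by (intro ext) (simp only: upd monomial_fun_Suc)
    then show ?thesis using False by simp
  qed
  have "?G (Suc K) (\<lambda>u. u $ i * monomial_fun \<alpha> u)
      = (\<Sum>j\<in>UNIV. x $ j * ?G K (\<lambda>u. u $ i * monomial_fun (?s j) u))"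
    by (subst gauss_power_Suc) (auto simp: monomial_fun_Suc mult_ac)
  also have "\<dots> = K * x $ i * (\<Sum>j\<in>UNIV. x $ j * ?G (K - 1) (monomial_fun (?s j)))
      + (\<Sum>j\<in>UNIV. x $ j * (?s j i * ?G K (monomial_fun ((?s j)(i := ?s j i - 1)))))"
    by (subst Suc.IH) (simp add: distrib_left sum.distrib sum_distrib_left mult_ac)
  \<comment> \<open>For \<open>K = 0\<close> both sides vanish through the factor \<open>K\<close>;
    otherwise the sum over \<open>j\<close> reassembles one factor
    \<open>x \<bullet> u\<close>.\<close>
  also have "K * x $ i * (\<Sum>j\<in>UNIV. x $ j * ?G (K - 1) (monomial_fun (?s j)))
      = K * x $ i * ?G K (monomial_fun \<alpha>)"
  proof (cases K)
    case (Suc L)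
    have "?G (Suc L) (monomial_fun \<alpha>)
      = (\<Sum>j\<in>UNIV. x $ j * ?G L (\<lambda>u. u $ j * monomial_fun \<alpha> u))"
      by (rule gauss_power_Suc) auto
    also have "\<dots> = (\<Sum>j\<in>UNIV. x $ j * ?G L (monomial_fun (?s j)))"
      by (simp add: monomial_fun_Suc[abs_def])
    finally show ?thesis using Suc by simp
  qed simp
  also have "(\<Sum>j\<in>UNIV. x $ j * (?s j i * ?G K (monomial_fun ((?s j)(i := ?s j i - 1)))))
      = x $ i * ?G K (monomial_fun \<alpha>)
        + \<alpha> i * (\<Sum>j\<in>UNIV. x $ j * ?G K (\<lambda>u. u $ j * monomial_fun ?p u))"
    unfolding deriv
    by (simp add: distrib_left sum.distrib sum_distrib_left mult_ac if_distrib[of "\<lambda>t. _ * t"]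
        cong: if_cong)
  also have "(\<Sum>j\<in>UNIV. x $ j * ?G K (\<lambda>u. u $ j * monomial_fun ?p u))
      = ?G (Suc K) (monomial_fun ?p)"
    by (rule gauss_power_Suc[symmetric]) auto
  finally show ?case by (simp add: algebra_simps fun_upd_def)
qed

text \<open>The variable \<open>x \<bullet> u\<close> is a centred Gaussian with standard deviation
  \<open>norm x\<close>. The proof descends from \<open>K\<close> to \<open>K - 2\<close> by
  integration by parts against the constant monomial.\<close>

lemma gauss_power_one:
  fixes x :: "real^'n"
  shows "gauss_power K x (\<lambda>_. 1) = std_normal_moment K * norm x ^ K"
proof (induction K rule: less_induct)
  case (less K)
  show ?case
  proof (cases K)
    case 0
    have "gauss (\<lambda>_::real^'n. 1) = 1"
      using gauss_monomial[of "\<lambda>_::'n. 0"] by (simp add: monomial_fun_zero[abs_def] std_normal_moment_0)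
    then show ?thesis using 0 by (simp add: gauss_power_def std_normal_moment_0)
  next
    case (Suc L)
    have "gauss_power K x (\<lambda>_. 1)
        = (\<Sum>j\<in>UNIV. x $ j * gauss_power L x (\<lambda>u. u $ j * monomial_fun (\<lambda>_. 0) u))"
      unfolding Suc by (subst gauss_power_Suc) auto
    also have "\<dots> = L * (\<Sum>j\<in>UNIV. x $ j * x $ j) * gauss_power (L - 1) x (\<lambda>_. 1)"
      unfolding gauss_power_mult_nth_monomial
      by (simp add: monomial_fun_zero[abs_def] sum_distrib_left sum_distrib_right mult_ac)
    also have "(\<Sum>j\<in>UNIV. x $ j * x $ j) = norm x ^ 2"
      by (simp add: power2_norm_eq_inner inner_vec_def)
    also have "L * (norm x)\<^sup>2 * gauss_power (L - 1) x (\<lambda>_. 1)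
        = L * (norm x)\<^sup>2 * (std_normal_moment (L - 1) * norm x ^ (L - 1))"
      using less.IH[of "L - 1"] Suc by simp
    also have "\<dots> = std_normal_moment K * norm x ^ K"
      unfolding Suc std_normal_moment_Suc by (cases L) (auto simp: power2_eq_square)
    finally show ?thesis .
  qed
qed

text \<open>Integrating by parts in \<open>u $ i * (u $ i * p u)\<close> and summing over
  \<open>i\<close> gives the divergence of \<open>u * p(u)\<close>. By Euler's identity this is the
  dimension plus the degree of \<open>p\<close>, times \<open>p\<close>; here \<open>p\<close> has
  degree \<open>K + sum \<alpha> UNIV\<close>.\<close>

lemma gauss_power_norm_mult_monomial:
  fixes x :: "real^'n"
  shows "gauss_power K x (\<lambda>u. (\<Sum>i\<in>UNIV. (u $ i)\<^sup>2) * monomial_fun \<alpha> u)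
    = (CARD('n) + K + sum \<alpha> UNIV) * gauss_power K x (monomial_fun \<alpha>)"
proof -
  let ?s = "\<lambda>j. \<alpha>(j := Suc (\<alpha> j))"
  have "gauss_power K x (\<lambda>u. (\<Sum>i\<in>UNIV. (u $ i)\<^sup>2) * monomial_fun \<alpha> u)
      = gauss_power K x (\<lambda>u. \<Sum>i\<in>UNIV. 1 * (u $ i * monomial_fun (?s i) u))"
    by (simp add: monomial_fun_Suc sum_distrib_right sum_distrib_left power2_eq_square mult_ac)
  also have "\<dots> = (\<Sum>i\<in>UNIV. gauss_power K x (\<lambda>u. u $ i * monomial_fun (?s i) u))"
    by (subst gauss_power_sum) auto
  also have "\<dots> = (\<Sum>i\<in>UNIV. K * (x $ i * gauss_power (K - 1) x (\<lambda>u. u $ i * monomial_fun \<alpha> u))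
      + (\<alpha> i + 1) * gauss_power K x (monomial_fun \<alpha>))"
    by (intro sum.cong refl)
      (simp only: gauss_power_mult_nth_monomial[of K x _ "?s _"],
       simp add: monomial_fun_Suc[abs_def] algebra_simps)
  also have "\<dots> = K * (\<Sum>i\<in>UNIV. x $ i * gauss_power (K - 1) x (\<lambda>u. u $ i * monomial_fun \<alpha> u))
      + (sum \<alpha> UNIV + CARD('n)) * gauss_power K x (monomial_fun \<alpha>)"
    by (simp add: sum.distrib sum_distrib_left sum_distrib_right distrib_right)
  also have "K * (\<Sum>i\<in>UNIV. x $ i * gauss_power (K - 1) x (\<lambda>u. u $ i * monomial_fun \<alpha> u))
      = K * gauss_power K x (monomial_fun \<alpha>)"
    by (cases K) (auto simp: gauss_power_Suc[OF real_polynomial_monomial_fun])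
  finally show ?thesis by (simp add: algebra_simps)
qed

section \<open>Forms with given coefficients\<close>

definition multi_indices :: "nat \<Rightarrow> ('n::finite \<Rightarrow> nat) set" where
  "multi_indices m = {\<alpha>. sum \<alpha> UNIV = m}"

lemma finite_multi_indices [simp]: "finite (multi_indices m :: ('n::finite \<Rightarrow> nat) set)"
proof (rule finite_subset)
  show "multi_indices m \<subseteq> (UNIV :: 'n set) \<rightarrow>\<^sub>E {..m}"
    by (auto simp: multi_indices_def PiE_def intro: member_le_sum)
qed (simp add: finite_PiE)

lemma multi_indices_0: "multi_indices 0 = {\<lambda>_. 0}"
  by (auto simp: multi_indices_def fun_eq_iff)

lemma fun_upd_Suc_in_multi_indices:
  "\<alpha> \<in> multi_indices m \<Longrightarrow> \<alpha>(i := Suc (\<alpha> i)) \<in> multi_indices (Suc m)"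
  by (simp add: multi_indices_def sum_fun_upd_Suc del: fun_upd_apply)

lemma fun_upd_pred_in_multi_indices:
  assumes "\<alpha> \<in> multi_indices (Suc m)" "0 < \<alpha> i"
  shows "\<alpha>(i := \<alpha> i - 1) \<in> multi_indices m"
  using assms sum_fun_upd_Suc[of "\<alpha>(i := \<alpha> i - 1)" i] by (simp add: multi_indices_def)

text \<open>Raising the \<open>i\<close>-th exponent is a bijection onto the indices with positive
  \<open>i\<close>-th entry. This is the reindexing behind both multiplication by a variable and
  differentiation.\<close>

lemma sum_multi_indices_Suc:
  fixes F :: "('n::finite \<Rightarrow> nat) \<Rightarrow> real"
  shows "(\<Sum>\<gamma>\<in>multi_indices (Suc m). if 0 < \<gamma> i then F \<gamma> else 0)
    = (\<Sum>\<beta>\<in>multi_indices m. F (\<beta>(i := Suc (\<beta> i))))"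
proof -
  have "(\<Sum>\<gamma>\<in>multi_indices (Suc m). if 0 < \<gamma> i then F \<gamma> else 0)
      = (\<Sum>\<gamma>\<in>{\<gamma> \<in> multi_indices (Suc m). 0 < \<gamma> i}. F \<gamma>)"
    by (rule sum.inter_filter[symmetric]) simp
  also have "\<dots> = (\<Sum>\<beta>\<in>multi_indices m. F (\<beta>(i := Suc (\<beta> i))))"
    by (rule sum.reindex_bij_witness[of _ "\<lambda>\<beta>. \<beta>(i := Suc (\<beta> i))" "\<lambda>\<gamma>. \<gamma>(i := \<gamma> i - 1)"])
      (use fun_upd_Suc_in_multi_indices fun_upd_pred_in_multi_indices in \<open>fastforce+\<close>)
  finally show ?thesis .
qed

text \<open>Forms are handled through explicit coefficient families, so that convergence of forms
  can be stated coefficient by coefficient.\<close>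

definition hpoly :: "nat \<Rightarrow> (('n::finite \<Rightarrow> nat) \<Rightarrow> real) \<Rightarrow> real^'n \<Rightarrow> real" where
  "hpoly m c x = (\<Sum>\<alpha>\<in>multi_indices m. c \<alpha> * monomial_fun \<alpha> x)"

lemma real_polynomial_hpoly [intro]: "real_polynomial_function (hpoly m c :: real^'n \<Rightarrow> real)"
proof -
  have "real_polynomial_function (\<lambda>x::real^'n. \<Sum>\<alpha>\<in>multi_indices m. c \<alpha> * monomial_fun \<alpha> x)"
    by (intro real_polynomial_function_sum real_polynomial_function.intros(3,4)) auto
  then show ?thesis unfolding hpoly_def .
qed

lemma hpoly_scaleR: "hpoly m c (t *\<^sub>R x) = t ^ m * hpoly m c x"
  unfolding hpoly_def sum_distrib_left
  by (rule sum.cong) (auto simp: monomial_fun_scaleR multi_indices_def)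

lemma hpoly_0: "hpoly 0 c x = c (\<lambda>_. 0)"
  by (simp add: hpoly_def multi_indices_0)

lemma hpoly_diff: "hpoly m (\<lambda>\<alpha>. c \<alpha> - b \<alpha>) x = hpoly m c x - hpoly m b x"
  by (simp add: hpoly_def left_diff_distrib sum_subtractf)

lemma hpoly_cmult: "hpoly m (\<lambda>\<alpha>. a * c \<alpha>) x = a * hpoly m c x"
  by (simp add: hpoly_def sum_distrib_left mult.assoc)

lemma hpoly_sum: "hpoly m (\<lambda>\<alpha>. \<Sum>j\<in>J. c j \<alpha>) x = (\<Sum>j\<in>J. hpoly m (c j) x)"
  unfolding hpoly_def sum_distrib_right by (rule sum.swap)

definition shift_coeffs ::
    "'n::finite \<Rightarrow> (('n \<Rightarrow> nat) \<Rightarrow> real) \<Rightarrow> ('n \<Rightarrow> nat) \<Rightarrow> real" where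
  "shift_coeffs i c \<gamma> = (if 0 < \<gamma> i then c (\<gamma>(i := \<gamma> i - 1)) else 0)"

definition deriv_coeffs ::
    "'n::finite \<Rightarrow> (('n \<Rightarrow> nat) \<Rightarrow> real) \<Rightarrow> ('n \<Rightarrow> nat) \<Rightarrow> real" where
  "deriv_coeffs i c \<gamma> = real (Suc (\<gamma> i)) * c (\<gamma>(i := Suc (\<gamma> i)))"

lemma hpoly_shift: "hpoly (Suc m) (shift_coeffs i c) u = u $ i * hpoly m c u"
proof -
  have "hpoly (Suc m) (shift_coeffs i c) u = (\<Sum>\<gamma>\<in>multi_indices (Suc m).
      if 0 < \<gamma> i then c (\<gamma>(i := \<gamma> i - 1)) * monomial_fun \<gamma> u else 0)"
    unfolding hpoly_def shift_coeffs_def by (rule sum.cong) auto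
  also have "\<dots> = (\<Sum>\<beta>\<in>multi_indices m. c \<beta> * monomial_fun (\<beta>(i := Suc (\<beta> i))) u)"
    unfolding sum_multi_indices_Suc by simp
  finally show ?thesis
    by (simp add: hpoly_def monomial_fun_Suc sum_distrib_left mult_ac del: fun_upd_apply)
qed

lemma hpoly_deriv:
  "hpoly m (deriv_coeffs i c) u
    = (\<Sum>\<beta>\<in>multi_indices (Suc m). c \<beta> * (\<beta> i * monomial_fun (\<beta>(i := \<beta> i - 1)) u))"
proof -
  have "(\<Sum>\<beta>\<in>multi_indices (Suc m). c \<beta> * (\<beta> i * monomial_fun (\<beta>(i := \<beta> i - 1)) u))
      = (\<Sum>\<beta>\<in>multi_indices (Suc m).
          if 0 < \<beta> i then c \<beta> * (\<beta> i * monomial_fun (\<beta>(i := \<beta> i - 1)) u) else 0)"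
    by (rule sum.cong) auto
  then show ?thesis
    unfolding sum_multi_indices_Suc by (simp add: hpoly_def deriv_coeffs_def mult_ac)
qed

section \<open>The Gaussian operator on forms and its normalised inverse\<close>

lemma gauss_power_hpoly:
  "gauss_power K x (hpoly m c) = (\<Sum>\<alpha>\<in>multi_indices m. c \<alpha> * gauss_power K x (monomial_fun \<alpha>))"
  unfolding hpoly_def[abs_def] by (rule gauss_power_sum) auto

lemma gauss_power_mult_nth_hpoly:
  fixes x :: "real^'n"
  shows "gauss_power K x (\<lambda>u. u $ i * hpoly (Suc m) c u)
    = K * x $ i * gauss_power (K - 1) x (hpoly (Suc m) c)
      + gauss_power K x (hpoly m (deriv_coeffs i c))"
proof -
  have "gauss_power K x (\<lambda>u. u $ i * hpoly (Suc m) c u)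
      = gauss_power K x (\<lambda>u. \<Sum>\<alpha>\<in>multi_indices (Suc m). c \<alpha> * (u $ i * monomial_fun \<alpha> u))"
    by (simp add: hpoly_def sum_distrib_left mult_ac)
  also have "\<dots> = (\<Sum>\<alpha>\<in>multi_indices (Suc m).
      c \<alpha> * gauss_power K x (\<lambda>u. u $ i * monomial_fun \<alpha> u))"
    by (rule gauss_power_sum) auto
  also have "\<dots> = K * x $ i * gauss_power (K - 1) x (hpoly (Suc m) c)
      + (\<Sum>\<alpha>\<in>multi_indices (Suc m).
          c \<alpha> * gauss_power K x (\<lambda>u. \<alpha> i * monomial_fun (\<alpha>(i := \<alpha> i - 1)) u))"
    unfolding gauss_power_mult_nth_monomial gauss_power_hpoly gauss_power_cmult
    by (simp add: distrib_left sum.distrib sum_distrib_left mult_ac)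
  also have "(\<Sum>\<alpha>\<in>multi_indices (Suc m).
          c \<alpha> * gauss_power K x (\<lambda>u. \<alpha> i * monomial_fun (\<alpha>(i := \<alpha> i - 1)) u))
      = gauss_power K x (hpoly m (deriv_coeffs i c))"
    unfolding hpoly_deriv[abs_def]
    by (rule gauss_power_sum[symmetric]) (intro real_polynomial_function.intros(2,4) real_polynomial_monomial_fun)
  finally show ?thesis .
qed

lemma gauss_power_norm_mult_hpoly:
  fixes x :: "real^'n"
  shows "gauss_power K x (\<lambda>u. (\<Sum>i\<in>UNIV. (u $ i)\<^sup>2) * hpoly m c u)
    = (CARD('n) + K + m) * gauss_power K x (hpoly m c)"
proof -
  let ?s = "\<lambda>u::real^'n. \<Sum>i\<in>UNIV. (u $ i)\<^sup>2"
  have "gauss_power K x (\<lambda>u. ?s u * hpoly m c u)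
      = gauss_power K x (\<lambda>u. \<Sum>\<alpha>\<in>multi_indices m. c \<alpha> * (?s u * monomial_fun \<alpha> u))"
    by (simp add: hpoly_def sum_distrib_left mult.left_commute)
  also have "\<dots> = (\<Sum>\<alpha>\<in>multi_indices m. c \<alpha> * gauss_power K x (\<lambda>u. ?s u * monomial_fun \<alpha> u))"
    by (rule gauss_power_sum)
      (intro real_polynomial_function.intros(4) real_polynomial_monomial_fun
        real_polynomial_function_sum real_polynomial_function_power real_polynomial_nth finite)
  also have "\<dots> = (\<Sum>\<alpha>\<in>multi_indices m.
      (CARD('n) + K + m) * (c \<alpha> * gauss_power K x (monomial_fun \<alpha>)))"
    by (rule sum.cong) (simp_all add: gauss_power_norm_mult_monomial multi_indices_def)
  finally show ?thesis by (simp add: gauss_power_hpoly sum_distrib_left)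
qed

text \<open>The operator sending a form \<open>q\<close> of degree \<open>m\<close> to the form \<open>x \<mapsto> gauss_power K x q\<close>
  has, up to normalisation, an inverse tending to the identity. Solving the integration by parts
  formula for its first term gives the recursion for the preimages of monomials: the derivative
  term is cancelled by the correction with the factor \<open>1 / (n + K + m - 1)\<close>, which vanishes
  in the limit.\<close>
lemma gauss_power_preimage_monomial:
  fixes \<alpha> :: "'n::finite \<Rightarrow> nat"
  assumes "\<alpha> \<in> multi_indices m"
  shows "\<exists>c. (\<forall>\<beta>. (\<lambda>K. c K \<beta>) \<longlonglongrightarrow> (if \<beta> = \<alpha> then 1 else 0)) \<and>
    (\<forall>K\<ge>m. \<forall>x::real^'n. gauss_power K x (hpoly m (c K))
      = fact K / fact (K - m) * std_normal_moment (K - m) * norm x ^ (K - m) * monomial_fun \<alpha> x)"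
  using assms
proof (induction m arbitrary: \<alpha>)
  case 0
  then have \<alpha>: "\<alpha> = (\<lambda>_. 0)" by (simp add: multi_indices_0)
  show ?case
  proof (intro exI[of _ "\<lambda>K \<beta>. if \<beta> = \<alpha> then 1 else 0"] conjI allI impI)
    fix K and x :: "real^'n"
    have "hpoly 0 (\<lambda>\<beta>. if \<beta> = \<alpha> then 1 else 0) = (\<lambda>_::real^'n. 1)"
      by (simp add: fun_eq_iff hpoly_0 \<alpha>)
    then show "gauss_power K x (hpoly 0 (\<lambda>\<beta>. if \<beta> = \<alpha> then 1 else 0))
        = fact K / fact (K - 0) * std_normal_moment (K - 0) * norm x ^ (K - 0) * monomial_fun \<alpha> x"
      by (simp add: gauss_power_one \<alpha>)
  qed simp
next
  case (Suc m)
  from Suc.prems obtain i where i: "0 < \<alpha> i"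
    by (force simp: multi_indices_def)
  define \<alpha>' where "\<alpha>' = \<alpha>(i := \<alpha> i - 1)"
  have \<alpha>': "\<alpha> = \<alpha>'(i := Suc (\<alpha>' i))" using i by (auto simp: \<alpha>'_def)
  obtain c where lim: "\<And>\<beta>. (\<lambda>K. c K \<beta>) \<longlonglongrightarrow> (if \<beta> = \<alpha>' then 1 else 0)"
    and c: "\<And>K x. K \<ge> m \<Longrightarrow> gauss_power K x (hpoly m (c K) :: real^'n \<Rightarrow> real)
      = fact K / fact (K - m) * std_normal_moment (K - m) * norm x ^ (K - m) * monomial_fun \<alpha>' x"
    using Suc.IH[OF fun_upd_pred_in_multi_indices[OF Suc.prems i]] unfolding \<alpha>'_def by blast
  \<comment> \<open>The preimage for \<open>\<alpha>\<close> at \<open>K\<close> is built from the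
    one for \<open>\<alpha>'\<close> at \<open>K - 1\<close>, because integration by parts uses up
    one factor \<open>x \<bullet> u\<close>.\<close>
  have lim': "(\<lambda>K. c (K - 1) \<beta>) \<longlonglongrightarrow> (if \<beta> = \<alpha>' then 1 else 0)" for \<beta>
    by (rule filterlim_compose[OF lim]) (rule filterlim_minus_const_nat_at_top)
  \<comment> \<open>Coefficients of the squared norm of \<open>u\<close> times the
    \<open>i\<close>-th derivative of the previous preimage. For \<open>m = 0\<close> that preimage
    is constant, hence the value 0.\<close>
  define r where "r K \<gamma> = (case m of 0 \<Rightarrow> 0 | Suc l \<Rightarrow>
      (\<Sum>j\<in>UNIV. shift_coeffs j (shift_coeffs j (deriv_coeffs i (c (K - 1)))) \<gamma>))" for K \<gamma>
  define b where "b K \<gamma> = shift_coeffs i (c (K - 1)) \<gamma> - 1 / (CARD('n) + K + m - 1) * r K \<gamma>" for K \<gamma>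
  have "(\<lambda>K. b K \<beta>) \<longlonglongrightarrow> (if \<beta> = \<alpha> then 1 else 0)" for \<beta>
  proof -
    \<comment> \<open>Convergence of \<open>r\<close> is enough, whatever its limit, since it is
      multiplied by a null sequence.\<close>
    have r: "convergent (\<lambda>K. r K \<beta>)"
    proof (cases m)
      case (Suc l)
      have shift: "convergent (\<lambda>K. shift_coeffs j (X K) \<gamma>)"
        if "\<And>\<gamma>. convergent (\<lambda>K. X K \<gamma>)" for X j \<gamma>
        using that by (cases "0 < \<gamma> j") (simp_all add: shift_coeffs_def convergent_const)
      have "convergent (\<lambda>K. deriv_coeffs i (c (K - 1)) \<gamma>)" for \<gamma>
        unfolding deriv_coeffs_def
        by (intro convergent_mult convergent_const) (rule convergentI[OF lim'])
      then show ?thesis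
        unfolding r_def Suc by (simp add: convergent_sum shift)
    qed (simp add: r_def convergent_const)
    then obtain l where l: "(\<lambda>K. r K \<beta>) \<longlonglongrightarrow> l"
      unfolding convergent_def by blast
    have "(\<lambda>K. 1 / real (CARD('n) + K + m - 1)) \<longlonglongrightarrow> 0"
      by (rule LIMSEQ_offset[of _ 1])
        (use LIMSEQ_ignore_initial_segment[OF lim_1_over_n, of "CARD('n) + m"] in \<open>simp add: add_ac\<close>)
    then have "(\<lambda>K. 1 / real (CARD('n) + K + m - 1) * r K \<beta>) \<longlonglongrightarrow> 0"
      using tendsto_mult[OF _ l] by fastforce
    moreover have "(\<lambda>K. shift_coeffs i (c (K - 1)) \<beta>) \<longlonglongrightarrow> (if \<beta> = \<alpha> then 1 else 0)"
    proof (cases "0 < \<beta> i")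
      case True
      then have "\<beta> = \<alpha> \<longleftrightarrow> \<beta>(i := \<beta> i - 1) = \<alpha>'"
        using i unfolding \<alpha>'_def by (metis Suc_diff_1 fun_upd_same fun_upd_triv fun_upd_upd)
      then show ?thesis using lim'[of "\<beta>(i := \<beta> i - 1)"] True by (simp add: shift_coeffs_def)
    next
      case False
      then show ?thesis using i by (auto simp: shift_coeffs_def)
    qed
    ultimately show ?thesis
      unfolding b_def using tendsto_diff by fastforce
  qed
  moreover have "gauss_power K x (hpoly (Suc m) (b K))
      = fact K / fact (K - Suc m) * std_normal_moment (K - Suc m) * norm x ^ (K - Suc m) * monomial_fun \<alpha> x"
    if K: "K \<ge> Suc m" for K and x :: "real^'n"
  proof -
    let ?q = "hpoly m (c (K - 1)) :: real^'n \<Rightarrow> real"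
    let ?N = "real (CARD('n) + K + m - 1)"
    have b: "hpoly (Suc m) (b K) = (\<lambda>u. u $ i * ?q u + (- (1 / ?N)) * hpoly (Suc m) (r K) u)"
      unfolding b_def by (intro ext) (simp only: hpoly_diff hpoly_shift hpoly_cmult, simp)
    have "gauss_power K x (hpoly (Suc m) (b K)) = gauss_power K x (\<lambda>u. u $ i * ?q u)
        + gauss_power K x (\<lambda>u. (- (1 / ?N)) * hpoly (Suc m) (r K) u)"
      unfolding b by (intro gauss_power_add real_polynomial_function.intros(2,4)
        real_polynomial_nth real_polynomial_hpoly)
    also have "\<dots> = gauss_power K x (\<lambda>u. u $ i * ?q u)
        - 1 / ?N * gauss_power K x (hpoly (Suc m) (r K))"
      unfolding gauss_power_cmult by simp
    also have "\<dots> = K * x $ i * gauss_power (K - 1) x ?q"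
    proof (cases m)
      case 0
      have "hpoly (Suc m) (r K) = (\<lambda>_::real^'n. 0 * 1)"
        by (simp add: r_def 0 hpoly_def fun_eq_iff)
      then have "gauss_power K x (hpoly (Suc m) (r K)) = 0"
        using gauss_power_cmult[of K x 0 "\<lambda>_. 1"] by simp
      moreover have "?q = (\<lambda>u. c (K - 1) (\<lambda>_. 0) * monomial_fun (\<lambda>_. 0) u)"
        by (simp add: 0 hpoly_0 fun_eq_iff)
      moreover have "gauss_power K x (\<lambda>u. u $ i * (c (K - 1) (\<lambda>_. 0) * monomial_fun (\<lambda>_. 0) u))
          = c (K - 1) (\<lambda>_. 0) * gauss_power K x (\<lambda>u. u $ i * monomial_fun (\<lambda>_. 0) u)"
        by (subst gauss_power_cmult[symmetric]) (simp add: mult_ac)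
      ultimately show ?thesis
        by (simp only: gauss_power_cmult gauss_power_mult_nth_monomial) (simp add: monomial_fun_zero[abs_def])
    next
      case (Suc l)
      let ?d = "hpoly l (deriv_coeffs i (c (K - 1))) :: real^'n \<Rightarrow> real"
      have "hpoly (Suc m) (r K) = (\<lambda>u. (\<Sum>j\<in>UNIV. (u $ j)\<^sup>2) * ?d u)"
        unfolding r_def Suc
        by (simp add: fun_eq_iff hpoly_sum hpoly_shift sum_distrib_right power2_eq_square mult.assoc)
      \<comment> \<open>The derivative has degree \<open>l = m - 1\<close>, so the factor produced
        by the squared norm is \<open>CARD('n) + K + l\<close>, which is exactly \<open>?N\<close>;
        the correction therefore cancels the derivative term.\<close>
      then have "gauss_power K x (hpoly (Suc m) (r K)) = ?N * gauss_power K x ?d"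
        by (simp add: gauss_power_norm_mult_hpoly Suc)
      moreover have "?N \<noteq> 0" using K Suc by simp
      ultimately show ?thesis
        unfolding Suc gauss_power_mult_nth_hpoly by simp
    qed
    also have "\<dots> = (K * (fact (K - 1) / fact (K - 1 - m))) * std_normal_moment (K - 1 - m)
        * norm x ^ (K - 1 - m) * (x $ i * monomial_fun \<alpha>' x)"
      using K by (subst c) auto
    also have "K * (fact (K - 1) / fact (K - 1 - m)) = fact K / (fact (K - Suc m) :: real)"
      using K by (simp add: fact_reduce[of K])
    also have "x $ i * monomial_fun \<alpha>' x = monomial_fun \<alpha> x"
      by (subst \<alpha>') (rule monomial_fun_Suc[symmetric])
    finally show ?thesis by simp
  qed
  ultimately show ?case by blast
qed

text \<open>By linearity, the preimages of the monomials are superposed with the coefficients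
  \<open>p\<close>.\<close>

lemma gauss_power_preimage:
  fixes p :: "('n::finite \<Rightarrow> nat) \<Rightarrow> real"
  shows "\<exists>c. (\<forall>\<beta>\<in>multi_indices m. (\<lambda>K. c K \<beta>) \<longlonglongrightarrow> p \<beta>) \<and>
    (\<forall>K\<ge>m. \<forall>x::real^'n. gauss_power K x (hpoly m (c K))
      = fact K / fact (K - m) * std_normal_moment (K - m) * norm x ^ (K - m) * hpoly m p x)"
proof -
  have "\<forall>\<alpha>\<in>multi_indices m. \<exists>c. (\<forall>\<beta>. (\<lambda>K. c K \<beta>) \<longlonglongrightarrow> (if \<beta> = \<alpha> then 1 else 0)) \<and>
    (\<forall>K\<ge>m. \<forall>x::real^'n. gauss_power K x (hpoly m (c K))
      = fact K / fact (K - m) * std_normal_moment (K - m) * norm x ^ (K - m) * monomial_fun \<alpha> x)"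
    using gauss_power_preimage_monomial by blast
  then obtain c where
    lim: "\<And>\<alpha> \<beta>. \<alpha> \<in> multi_indices m \<Longrightarrow> (\<lambda>K. c \<alpha> K \<beta>) \<longlonglongrightarrow> (if \<beta> = \<alpha> then 1 else 0)"
    and c: "\<And>\<alpha> K x. \<alpha> \<in> multi_indices m \<Longrightarrow> K \<ge> m \<Longrightarrow>
      gauss_power K x (hpoly m (c \<alpha> K) :: real^'n \<Rightarrow> real)
      = fact K / fact (K - m) * std_normal_moment (K - m) * norm x ^ (K - m) * monomial_fun \<alpha> x"
    by metis
  define b where "b K \<beta> = (\<Sum>\<alpha>\<in>multi_indices m. p \<alpha> * c \<alpha> K \<beta>)" for K \<beta>
  have "(\<lambda>K. b K \<beta>) \<longlonglongrightarrow> p \<beta>" if "\<beta> \<in> multi_indices m" for \<beta>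
  proof -
    have "(\<lambda>K. b K \<beta>) \<longlonglongrightarrow> (\<Sum>\<alpha>\<in>multi_indices m. p \<alpha> * (if \<beta> = \<alpha> then 1 else 0))"
      unfolding b_def by (intro tendsto_sum tendsto_mult tendsto_const lim)
    also have "(\<Sum>\<alpha>\<in>multi_indices m. p \<alpha> * (if \<beta> = \<alpha> then 1 else 0)) = p \<beta>"
      using that by (simp add: if_distrib[of "\<lambda>t. _ * t"] cong: if_cong)
    finally show ?thesis .
  qed
  moreover have "gauss_power K x (hpoly m (b K))
      = fact K / fact (K - m) * std_normal_moment (K - m) * norm x ^ (K - m) * hpoly m p x"
    if K: "K \<ge> m" for K and x :: "real^'n"
  proof -
    have "hpoly m (b K) = (\<lambda>u::real^'n. \<Sum>\<alpha>\<in>multi_indices m. p \<alpha> * hpoly m (c \<alpha> K) u)"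
      unfolding b_def by (simp add: fun_eq_iff hpoly_sum hpoly_cmult)
    then have "gauss_power K x (hpoly m (b K))
        = (\<Sum>\<alpha>\<in>multi_indices m. p \<alpha> * gauss_power K x (hpoly m (c \<alpha> K)))"
      by (simp only: gauss_power_sum[OF real_polynomial_hpoly])
    also have "\<dots> = fact K / fact (K - m) * std_normal_moment (K - m) * norm x ^ (K - m) * hpoly m p x"
      using K by (simp add: c hpoly_def sum_distrib_left sum_divide_distrib mult_ac)
    finally show ?thesis .
  qed
  ultimately show ?thesis by blast
qed

section \<open>Sums of squares\<close>

text \<open>Lagrange's reduction by completing squares, eliminating one index \<open>z\<close> at a
  time. A zero diagonal entry forces its row to vanish; a positive one splits off a square and
  leaves a nonnegative Schur complement.\<close>

lemma sym_nonneg_form_sum_of_squares: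
  fixes G :: "'a \<Rightarrow> 'a \<Rightarrow> real"
  assumes "finite I" "\<And>a b. G a b = G b a"
    and "\<And>v. 0 \<le> (\<Sum>a\<in>I. \<Sum>b\<in>I. G a b * v a * v b)"
  shows "\<exists>ls. \<forall>v. (\<Sum>a\<in>I. \<Sum>b\<in>I. G a b * v a * v b) = (\<Sum>l\<leftarrow>ls. (\<Sum>a\<in>I. l a * v a)\<^sup>2)"
  using assms
proof (induction I arbitrary: G rule: finite_induct)
  case empty
  show ?case by (intro exI[of _ "[]"]) simp
next
  case (insert z I)
  let ?Q = "\<lambda>G v. \<Sum>a\<in>I. \<Sum>b\<in>I. G a b * v a * v b"
  let ?S = "\<lambda>v. \<Sum>a\<in>I. G z a * v a"
  have expand: "(\<Sum>a\<in>insert z I. \<Sum>b\<in>insert z I. G a b * v a * v b)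
      = G z z * (v z)\<^sup>2 + 2 * v z * ?S v + ?Q G v" for v
  proof -
    have "(\<Sum>a\<in>I. G a z * v a * v z) = v z * ?S v"
      unfolding insert.prems(1)[of _ z] by (simp add: sum_distrib_left mult_ac)
    moreover have "(\<Sum>b\<in>I. G z b * v z * v b) = v z * ?S v"
      by (simp add: sum_distrib_left mult_ac)
    ultimately show ?thesis
      using insert.hyps by (simp add: sum.distrib power2_eq_square algebra_simps)
  qed
  have nonneg: "0 \<le> G z z * (v z)\<^sup>2 + 2 * v z * ?S v + ?Q G v" for v
    using insert.prems(2)[of v] unfolding expand .
  have zero: "(\<Sum>a\<in>I. (l(z := t)) a * v a) = (\<Sum>a\<in>I. l a * v a)" for l t and v :: "'a \<Rightarrow> real"
    using insert.hyps by (intro sum.cong) auto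
  have "0 \<le> G z z"
  proof -
    have "?Q G (\<lambda>a. if a = z then 1 else 0) = 0" "?S (\<lambda>a. if a = z then 1 else 0) = 0"
      using insert.hyps by (auto intro!: sum.neutral)
    then show ?thesis using nonneg[of "\<lambda>a. if a = z then 1 else 0"] by simp
  qed
  then consider "G z z = 0" | "0 < G z z" by linarith
  then show ?case
  proof cases
    case 1
    have off: "G z a = 0" if a: "a \<in> I" for a
    proof (rule ccontr)
      assume s: "G z a \<noteq> 0"
      \<comment> \<open>Chosen so that the form takes the value -1 at the vector with entry 1 at
        \<open>a\<close> and \<open>t\<close> at \<open>z\<close>.\<close>
      define t where "t = - (G a a + 1) / (2 * G z a)"
      let ?v = "\<lambda>x. if x = a then 1 else if x = z then t else 0"
      have az: "a \<noteq> z" using a insert.hyps by auto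
      have "?S ?v = (\<Sum>x\<in>I. if x = a then G z x else 0)"
        using insert.hyps by (intro sum.cong) auto
      also have "\<dots> = G z a" using insert.hyps a by simp
      finally have S: "?S ?v = G z a" .
      have "?Q G ?v = (\<Sum>x\<in>I. \<Sum>y\<in>I. if x = a then if y = a then G x y else 0 else 0)"
        using insert.hyps by (intro sum.cong) auto
      also have "\<dots> = (\<Sum>x\<in>I. if x = a then G x a else 0)"
        using insert.hyps a by (intro sum.cong) auto
      also have "\<dots> = G a a" using insert.hyps a by simp
      finally have "0 \<le> 2 * t * G z a + G a a"
        using nonneg[of ?v] S 1 az by simp
      also have "2 * t * G z a = - (G a a + 1)" using s by (simp add: t_def)
      finally show False by simp
    qed
    then have S: "?S v = 0" for v by simp
    have "\<And>v. 0 \<le> ?Q G v" using nonneg 1 S by simp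
    then obtain ls where ls: "\<And>v. ?Q G v = (\<Sum>l\<leftarrow>ls. (\<Sum>a\<in>I. l a * v a)\<^sup>2)"
      using insert.IH[of G] insert.prems(1) by blast
    show ?thesis
    \<comment> \<open>The linear forms found on \<open>I\<close> are extended by the coefficient 0
      at \<open>z\<close>.\<close>
    proof (intro exI[of _ "map (\<lambda>l. l(z := 0)) ls"] allI)
      fix v
      show "(\<Sum>a\<in>insert z I. \<Sum>b\<in>insert z I. G a b * v a * v b)
          = (\<Sum>l\<leftarrow>map (\<lambda>l. l(z := 0)) ls. (\<Sum>a\<in>insert z I. l a * v a)\<^sup>2)"
        unfolding expand using insert.hyps
        by (simp add: 1 S ls o_def zero del: fun_upd_apply) (simp add: zero)
    qed
  next
    case 2
    let ?g = "G z z"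
    \<comment> \<open>The Schur complement of the pivot \<open>G z z\<close>.\<close>
    define G' where "G' a b = G a b - G z a * G z b / ?g" for a b
    have G': "?Q G' v = ?Q G v - (?S v)\<^sup>2 / ?g" for v
    proof -
      have "?Q G' v = ?Q G v - (\<Sum>a\<in>I. \<Sum>b\<in>I. (G z a * v a) * (G z b * v b) / ?g)"
        unfolding G'_def sum_subtractf[symmetric]
        by (intro sum.cong refl) (simp add: algebra_simps)
      also have "(\<Sum>a\<in>I. \<Sum>b\<in>I. (G z a * v a) * (G z b * v b) / ?g) = (?S v)\<^sup>2 / ?g"
        by (simp add: power2_eq_square sum_product sum_divide_distrib)
      finally show ?thesis .
    qed
    have "0 \<le> ?Q G' v" for v
    proof -
      \<comment> \<open>The entry at \<open>z\<close> minimises the form with the other entries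
        fixed; the minimum is the Schur complement form at \<open>v\<close>.\<close>
      define w where "w = v(z := - ?S v / ?g)"
      have "?S w = ?S v" "?Q G w = ?Q G v" "w z = - ?S v / ?g"
        using insert.hyps by (auto simp: w_def intro!: sum.cong)
      then have "0 \<le> ?g * (?S v / ?g)\<^sup>2 - 2 * (?S v / ?g) * ?S v + ?Q G v"
        using nonneg[of w] by simp
      also have "\<dots> = ?Q G' v"
        unfolding G' using 2 by (simp add: power2_eq_square field_simps)
      finally show ?thesis .
    qed
    moreover have "G' a b = G' b a" for a b
      unfolding G'_def using insert.prems(1) by (simp add: mult.commute)
    ultimately obtain ls where ls: "\<And>v. ?Q G' v = (\<Sum>l\<leftarrow>ls. (\<Sum>a\<in>I. l a * v a)\<^sup>2)"
      using insert.IH[of G'] by blast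
    show ?thesis
    proof (intro exI[of _ "(\<lambda>a. G z a / sqrt ?g) # map (\<lambda>l. l(z := 0)) ls"] allI)
      fix v
      have "(\<Sum>a\<in>insert z I. G z a / sqrt ?g * v a) = (?g * v z + ?S v) / sqrt ?g"
        using insert.hyps by (simp add: add_divide_distrib sum_divide_distrib)
      then have "(\<Sum>a\<in>insert z I. G z a / sqrt ?g * v a)\<^sup>2 = (?g * v z + ?S v)\<^sup>2 / ?g"
        using 2 by (simp add: power_divide)
      also have "\<dots> = ?g * (v z)\<^sup>2 + 2 * v z * ?S v + (?S v)\<^sup>2 / ?g"
        using 2 by (simp add: power2_eq_square field_simps)
      finally have sq: "(\<Sum>a\<in>insert z I. G z a / sqrt ?g * v a)\<^sup>2
        = ?g * (v z)\<^sup>2 + 2 * v z * ?S v + (?S v)\<^sup>2 / ?g" .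
      have rest: "(\<Sum>l\<leftarrow>map (\<lambda>l. l(z := 0)) ls. (\<Sum>a\<in>insert z I. l a * v a)\<^sup>2) = ?Q G' v"
        unfolding ls using insert.hyps
        by (simp add: o_def zero del: fun_upd_apply) (simp add: zero)
      show "(\<Sum>a\<in>insert z I. \<Sum>b\<in>insert z I. G a b * v a * v b)
        = (\<Sum>l\<leftarrow>(\<lambda>a. G z a / sqrt ?g) # map (\<lambda>l. l(z := 0)) ls. (\<Sum>a\<in>insert z I. l a * v a)\<^sup>2)"
        unfolding expand list.map sum_list.Cons sq rest G' by simp
    qed
  qed
qed

text \<open>Averaging \<open>G\<close> with its transpose leaves the quadratic form unchanged and
  makes the matrix symmetric. The Gram matrices used below come without a symmetry
  assumption.\<close>

lemma nonneg_form_sum_of_squares: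
  fixes G :: "'a \<Rightarrow> 'a \<Rightarrow> real"
  assumes "finite I" and nonneg: "\<And>v. 0 \<le> (\<Sum>a\<in>I. \<Sum>b\<in>I. G a b * v a * v b)"
  obtains ls where
    "\<And>v. (\<Sum>a\<in>I. \<Sum>b\<in>I. G a b * v a * v b) = (\<Sum>l\<leftarrow>ls. (\<Sum>a\<in>I. l a * v a)\<^sup>2)"
proof -
  have sym: "(\<Sum>a\<in>I. \<Sum>b\<in>I. (G a b + G b a) / 2 * v a * v b) = (\<Sum>a\<in>I. \<Sum>b\<in>I. G a b * v a * v b)"
    for v
  proof -
    have "(\<Sum>a\<in>I. \<Sum>b\<in>I. G b a * v a * v b) = (\<Sum>a\<in>I. \<Sum>b\<in>I. G a b * v a * v b)"
      by (subst sum.swap) (simp add: mult_ac)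
    moreover have "(\<Sum>a\<in>I. \<Sum>b\<in>I. (G a b + G b a) / 2 * v a * v b)
        = ((\<Sum>a\<in>I. \<Sum>b\<in>I. G a b * v a * v b) + (\<Sum>a\<in>I. \<Sum>b\<in>I. G b a * v a * v b)) / 2"
      by (simp add: sum.distrib[symmetric] sum_divide_distrib field_simps)
    ultimately show ?thesis by simp
  qed
  show thesis
    using sym_nonneg_form_sum_of_squares[of I "\<lambda>a b. (G a b + G b a) / 2"] assms that
    unfolding sym by (auto simp: add.commute)
qed

section \<open>Gram representation of Gaussian biforms\<close>

text \<open>The multinomial theorem with coefficients given by a Pascal-type recursion. It makes the
  power linear in the monomials of \<open>x\<close>, which serve as the Gram basis.\<close>

lemma inner_power_expansion:
  "\<exists>b. \<forall>x u. (x \<bullet> u) ^ N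
    = (\<Sum>\<alpha>\<in>multi_indices N. b \<alpha> * monomial_fun \<alpha> x * monomial_fun \<alpha> (u :: real^'n::finite))"
proof (induction N)
  case 0
  show ?case by (intro exI[of _ "\<lambda>_. 1"]) (simp add: multi_indices_0)
next
  case (Suc N)
  then obtain b where b: "\<And>x u :: real^'n. (x \<bullet> u) ^ N
    = (\<Sum>\<alpha>\<in>multi_indices N. b \<alpha> * monomial_fun \<alpha> x * monomial_fun \<alpha> u)" by blast
  let ?b = "\<lambda>\<gamma>. \<Sum>i\<in>UNIV. shift_coeffs i b \<gamma>"
  have "(x \<bullet> u) ^ Suc N
      = (\<Sum>\<gamma>\<in>multi_indices (Suc N). ?b \<gamma> * monomial_fun \<gamma> x * monomial_fun \<gamma> u)" for x u :: "real^'n"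
  proof -
    have "(x \<bullet> u) ^ Suc N = (\<Sum>i\<in>UNIV. \<Sum>\<beta>\<in>multi_indices N.
        b \<beta> * monomial_fun (\<beta>(i := Suc (\<beta> i))) x * monomial_fun (\<beta>(i := Suc (\<beta> i))) u)"
      by (simp only: power_Suc b) (simp add: inner_vec_def monomial_fun_Suc sum_product mult_ac
          del: fun_upd_apply)
    also have "\<dots> = (\<Sum>i\<in>UNIV. \<Sum>\<gamma>\<in>multi_indices (Suc N).
        shift_coeffs i b \<gamma> * monomial_fun \<gamma> x * monomial_fun \<gamma> u)"
    proof (rule sum.cong[OF refl])
      fix i
      have "(\<Sum>\<gamma>\<in>multi_indices (Suc N). shift_coeffs i b \<gamma> * monomial_fun \<gamma> x * monomial_fun \<gamma> u)
          = (\<Sum>\<gamma>\<in>multi_indices (Suc N).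
              if 0 < \<gamma> i then b (\<gamma>(i := \<gamma> i - 1)) * monomial_fun \<gamma> x * monomial_fun \<gamma> u else 0)"
        by (rule sum.cong) (auto simp: shift_coeffs_def)
      then show "(\<Sum>\<beta>\<in>multi_indices N.
            b \<beta> * monomial_fun (\<beta>(i := Suc (\<beta> i))) x * monomial_fun (\<beta>(i := Suc (\<beta> i))) u)
          = (\<Sum>\<gamma>\<in>multi_indices (Suc N). shift_coeffs i b \<gamma> * monomial_fun \<gamma> x * monomial_fun \<gamma> u)"
        unfolding sum_multi_indices_Suc by simp
    qed
    also have "\<dots> = (\<Sum>\<gamma>\<in>multi_indices (Suc N). ?b \<gamma> * monomial_fun \<gamma> x * monomial_fun \<gamma> u)"
      by (subst sum.swap) (simp add: sum_distrib_right)
    finally show ?thesis .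
  qed
  then show ?case by (intro exI[of _ ?b] allI)
qed

lemma is_poly2_bilinear:
  "is_poly2 (\<lambda>x y :: real^'n::finite.
    \<Sum>p\<in>multi_indices N \<times> UNIV. l p * (monomial_fun (fst p) x * y $ snd p))"
proof -
  \<comment> \<open>Unit exponent vectors: \<open>y $ i\<close> is the monomial with exponent
    \<open>e i\<close>, as the encoding in \<open>is_poly2\<close> requires.\<close>
  define e where "e i = (\<lambda>j. if j = i then 1 else 0 :: nat)" for i :: 'n
  have inj: "inj e" by (rule injI) (auto simp: e_def fun_eq_iff split: if_splits)
  have e: "monomial_fun (e i) y = y $ i" for i and y :: "real^'n"
  proof -
    have "monomial_fun (e i) y = (\<Prod>j\<in>UNIV. if j = i then y $ j else 1)"
      unfolding monomial_fun_def e_def by (rule prod.cong) auto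
    then show ?thesis by simp
  qed
  let ?h = "\<lambda>p. (fst p, e (snd p))"
  show ?thesis
    unfolding is_poly2_def
  proof (intro exI conjI allI)
    show "finite (?h ` (multi_indices N \<times> UNIV))" by simp
    fix x y :: "real^'n"
    have "inj_on ?h (multi_indices N \<times> UNIV)"
      using inj by (auto simp: inj_on_def)
    then show "(\<Sum>p\<in>multi_indices N \<times> UNIV. l p * (monomial_fun (fst p) x * y $ snd p))
      = (\<Sum>(\<alpha>, \<beta>)\<in>?h ` (multi_indices N \<times> UNIV).
          l (\<alpha>, inv e \<beta>) * monomial_fun \<alpha> x * monomial_fun \<beta> y)"
      by (subst sum.reindex) (auto simp: e inv_f_f[OF inj] intro!: sum.cong)
  qed
qed

text \<open>The Gram matrix of the biform in the monomials \<open>x\<^sup>\<alpha> y\<^sub>i\<close> is a Gaussian moment matrix, so it is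
  positive semidefinite as soon as the weight is.\<close>
lemma is_sos2_gauss_power:
  fixes Q :: "'n \<Rightarrow> 'n \<Rightarrow> ('n::finite \<Rightarrow> nat) \<Rightarrow> real"
  assumes nonneg: "\<And>u y :: real^'n. 0 \<le> (\<Sum>i\<in>UNIV. \<Sum>j\<in>UNIV. y $ i * y $ j * hpoly m (Q i j) u)"
  shows "is_sos2 (\<lambda>x y. \<Sum>i\<in>UNIV. \<Sum>j\<in>UNIV. y $ i * y $ j * gauss_power (2 * N) x (hpoly m (Q i j)))"
proof -
  obtain b where b: "\<And>x u :: real^'n. (x \<bullet> u) ^ N
    = (\<Sum>\<alpha>\<in>multi_indices N. b \<alpha> * monomial_fun \<alpha> x * monomial_fun \<alpha> u)"
    using inner_power_expansion by blast
  let ?I = "multi_indices N \<times> (UNIV :: 'n set)"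
  \<comment> \<open>The Gaussian mean of \<open>h p q\<close> is the Gram entry at \<open>p\<close>
    and \<open>q\<close>.\<close>
  define h :: "('n \<Rightarrow> nat) \<times> 'n \<Rightarrow> ('n \<Rightarrow> nat) \<times> 'n \<Rightarrow> real^'n \<Rightarrow> real" where
    "h p q u = b (fst p) * monomial_fun (fst p) u * (b (fst q) * monomial_fun (fst q) u)
      * hpoly m (Q (snd p) (snd q)) u" for p q u
  \<comment> \<open>For fixed \<open>u\<close>, a coefficient vector \<open>v\<close> collapses to a
    vector in \<open>real^'n\<close>, the argument at which the matrix \<open>Q\<close> at
    \<open>u\<close> is evaluated.\<close>
  define w :: "(('n \<Rightarrow> nat) \<times> 'n \<Rightarrow> real) \<Rightarrow> real^'n \<Rightarrow> 'n \<Rightarrow> real" where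
    "w v u i = (\<Sum>\<alpha>\<in>multi_indices N. b \<alpha> * monomial_fun \<alpha> u * v (\<alpha>, i))" for v u i
  have h: "real_polynomial_function (h p q)" for p q
    unfolding h_def[abs_def]
    by (intro real_polynomial_function.intros(2,4) real_polynomial_hpoly real_polynomial_monomial_fun)
  have gram: "(\<Sum>p\<in>?I. \<Sum>q\<in>?I. gauss (h p q) * v p * v q)
      = gauss (\<lambda>u. \<Sum>i\<in>UNIV. \<Sum>j\<in>UNIV. w v u i * w v u j * hpoly m (Q i j) u)" for v
  proof -
    have "(\<Sum>i\<in>UNIV. \<Sum>j\<in>UNIV. w v u i * w v u j * hpoly m (Q i j) u)
        = (\<Sum>r\<in>?I \<times> ?I. (v (fst r) * v (snd r)) * h (fst r) (snd r) u)" for u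
    proof -
      have "(\<Sum>r\<in>?I \<times> ?I. (v (fst r) * v (snd r)) * h (fst r) (snd r) u)
          = (\<Sum>\<alpha>\<in>multi_indices N. \<Sum>i\<in>UNIV. \<Sum>\<beta>\<in>multi_indices N. \<Sum>j\<in>UNIV.
              v (\<alpha>, i) * v (\<beta>, j) * h (\<alpha>, i) (\<beta>, j) u)"
        by (simp only: sum.cartesian_product' fst_conv snd_conv)
      also have "\<dots> = (\<Sum>i\<in>UNIV. \<Sum>\<alpha>\<in>multi_indices N. \<Sum>j\<in>UNIV. \<Sum>\<beta>\<in>multi_indices N.
              v (\<alpha>, i) * v (\<beta>, j) * h (\<alpha>, i) (\<beta>, j) u)"
        by (subst sum.swap) (intro sum.cong refl sum.swap)
      also have "\<dots> = (\<Sum>i\<in>UNIV. \<Sum>j\<in>UNIV. \<Sum>\<alpha>\<in>multi_indices N. \<Sum>\<beta>\<in>multi_indices N.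
              v (\<alpha>, i) * v (\<beta>, j) * h (\<alpha>, i) (\<beta>, j) u)"
        by (intro sum.cong refl sum.swap)
      also have "\<dots> = (\<Sum>i\<in>UNIV. \<Sum>j\<in>UNIV. w v u i * w v u j * hpoly m (Q i j) u)"
        by (intro sum.cong refl)
          (simp only: w_def sum_product, simp only: sum_distrib_right, simp add: h_def mult_ac)
      finally show ?thesis by simp
    qed
    then have "gauss (\<lambda>u. \<Sum>i\<in>UNIV. \<Sum>j\<in>UNIV. w v u i * w v u j * hpoly m (Q i j) u)
        = (\<Sum>r\<in>?I \<times> ?I. (v (fst r) * v (snd r)) * gauss (h (fst r) (snd r)))"
      by (simp only: gauss_sum[OF h])
    also have "\<dots> = (\<Sum>p\<in>?I. \<Sum>q\<in>?I. gauss (h p q) * v p * v q)"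
      by (subst sum.cartesian_product) (simp add: split_def mult_ac)
    finally show ?thesis by simp
  qed
  have psd: "0 \<le> (\<Sum>p\<in>?I. \<Sum>q\<in>?I. gauss (h p q) * v p * v q)" for v
    unfolding gram
  proof (rule gauss_nonneg)
    fix u
    show "0 \<le> (\<Sum>i\<in>UNIV. \<Sum>j\<in>UNIV. w v u i * w v u j * hpoly m (Q i j) u)"
      using nonneg[of "\<chi> i. w v u i" u] by simp
  qed
  obtain ls where ls: "\<And>v. (\<Sum>p\<in>?I. \<Sum>q\<in>?I. gauss (h p q) * v p * v q)
      = (\<Sum>l\<leftarrow>ls. (\<Sum>p\<in>?I. l p * v p)\<^sup>2)"
    using nonneg_form_sum_of_squares[OF _ psd] by auto
  have eq: "(\<Sum>i\<in>UNIV. \<Sum>j\<in>UNIV. y $ i * y $ j * gauss_power (2 * N) x (hpoly m (Q i j)))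
      = (\<Sum>l\<leftarrow>ls. (\<Sum>p\<in>?I. l p * (monomial_fun (fst p) x * y $ snd p))\<^sup>2)" for x y
  proof -
    \<comment> \<open>At the actual monomials of \<open>x\<close> and \<open>y\<close>, the
      collapsed vector is \<open>(x \<bullet> u) ^ N\<close> times \<open>y\<close>, so the Gram
      form becomes the biform with exponent \<open>2 * N\<close>.\<close>
    let ?v = "\<lambda>p. monomial_fun (fst p) x * y $ snd p"
    have w: "w ?v u i = (x \<bullet> u) ^ N * y $ i" for u i
      unfolding w_def b by (simp add: sum_distrib_left mult_ac)
    have "(\<Sum>l\<leftarrow>ls. (\<Sum>p\<in>?I. l p * ?v p)\<^sup>2)
        = gauss (\<lambda>u. \<Sum>i\<in>UNIV. \<Sum>j\<in>UNIV. w ?v u i * w ?v u j * hpoly m (Q i j) u)"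
      unfolding ls[symmetric] gram ..
    also have "\<dots> = gauss_power (2 * N) x
        (\<lambda>u. \<Sum>r\<in>UNIV \<times> UNIV. (y $ fst r * y $ snd r) * hpoly m (Q (fst r) (snd r)) u)"
      unfolding gauss_power_def w sum.cartesian_product mult_2 power_add
      by (simp add: split_def sum_distrib_left mult_ac)
    also have "\<dots> = (\<Sum>r\<in>UNIV \<times> UNIV.
        (y $ fst r * y $ snd r) * gauss_power (2 * N) x (hpoly m (Q (fst r) (snd r))))"
      by (rule gauss_power_sum) auto
    also have "\<dots> = (\<Sum>i\<in>UNIV. \<Sum>j\<in>UNIV. y $ i * y $ j * gauss_power (2 * N) x (hpoly m (Q i j)))"
      by (subst sum.cartesian_product) (simp add: split_def)
    finally show ?thesis by simp
  qed
  let ?qs = "map (\<lambda>l x y. \<Sum>p\<in>?I. l p * (monomial_fun (fst p) x * y $ snd p)) ls"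
  show ?thesis
    unfolding is_sos2_def eq
  proof (intro exI[of _ ?qs] conjI allI ballI)
    fix q assume "q \<in> set ?qs"
    then show "is_poly2 q" using is_poly2_bilinear by auto
  qed (simp add: o_def)
qed

section \<open>Hessians of forms\<close>

lemma DERIV_monomial_fun_axis:
  fixes x :: "real^'n"
  shows "((\<lambda>t. monomial_fun \<alpha> (x + t *\<^sub>R axis i 1)) has_real_derivative
    \<alpha> i * monomial_fun (\<alpha>(i := \<alpha> i - 1)) x) (at 0)"
proof -
  let ?P = "\<Prod>j\<in>UNIV - {i}. (x $ j) ^ \<alpha> j"
  have "monomial_fun \<alpha> (x + t *\<^sub>R axis i 1) = (x $ i + t) ^ \<alpha> i * ?P" for t
    unfolding monomial_fun_def
    by (subst prod.remove[of _ i]) (auto simp: axis_def intro!: prod.cong)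
  moreover have "monomial_fun (\<alpha>(i := \<alpha> i - 1)) x = (x $ i) ^ (\<alpha> i - 1) * ?P"
    unfolding monomial_fun_def by (subst prod.remove[of _ i]) (auto intro!: prod.cong)
  moreover have "((\<lambda>t. (x $ i + t) ^ \<alpha> i * ?P) has_real_derivative
      \<alpha> i * ((x $ i) ^ (\<alpha> i - 1) * ?P)) (at 0)"
    by (auto intro!: derivative_eq_intros)
  ultimately show ?thesis by simp
qed

lemma partial_hpoly: "partial i (hpoly (Suc m) c) = hpoly m (deriv_coeffs i c)"
proof
  fix x :: "real^'a"
  have "((\<lambda>t. hpoly (Suc m) c (x + t *\<^sub>R axis i 1)) has_real_derivative
      hpoly m (deriv_coeffs i c) x) (at 0)"
    unfolding hpoly_deriv unfolding hpoly_def
    by (intro DERIV_sum DERIV_cmult DERIV_monomial_fun_axis)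
  then show "partial i (hpoly (Suc m) c) x = hpoly m (deriv_coeffs i c) x"
    unfolding partial_def by (rule DERIV_imp_deriv)
qed

lemma hessian_hpoly:
  "hessian (hpoly (Suc (Suc m)) c) x $ i $ j = hpoly m (deriv_coeffs i (deriv_coeffs j c)) x"
  by (simp add: hessian_def partial_hpoly)

lemma quadratic_form_eq_sum:
  "y \<bullet> (A *v y) = (\<Sum>i\<in>UNIV. \<Sum>j\<in>UNIV. y $ i * y $ j * A $ i $ j)"
  by (simp add: inner_vec_def matrix_vector_mult_def sum_distrib_left mult_ac)

lemma is_form_imp_hpoly:
  assumes "is_form d f"
  obtains c where "f = hpoly d c"
proof -
  obtain A c where A: "finite A" "\<forall>\<alpha>\<in>A. sum \<alpha> UNIV = d"
    and f: "\<And>x. f x = (\<Sum>\<alpha>\<in>A. c \<alpha> * monomial_fun \<alpha> x)"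
    using assms unfolding is_form_def by blast
  have sub: "A \<subseteq> multi_indices d" using A by (auto simp: multi_indices_def)
  have "f = hpoly d (\<lambda>\<alpha>. if \<alpha> \<in> A then c \<alpha> else 0)"
  proof
    fix x
    show "f x = hpoly d (\<lambda>\<alpha>. if \<alpha> \<in> A then c \<alpha> else 0) x"
      unfolding f hpoly_def using sub
      by (intro sum.mono_neutral_cong_left finite_multi_indices) auto
  qed
  then show thesis by (rule that)
qed

lemma sum_squares_power_eq_hpoly:
  obtains e where "(\<lambda>x::real^'n. (\<Sum>i\<in>UNIV. (x $ i)\<^sup>2) ^ k) = hpoly (2 * k) e"
proof -
  have "\<exists>e. \<forall>x::real^'n. (\<Sum>i\<in>UNIV. (x $ i)\<^sup>2) ^ k = hpoly (2 * k) e x"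
  proof (induction k)
    case 0
    show ?case by (intro exI[of _ "\<lambda>_. 1"]) (simp add: hpoly_0)
  next
    case (Suc k)
    then obtain e where e: "\<And>x::real^'n. (\<Sum>i\<in>UNIV. (x $ i)\<^sup>2) ^ k = hpoly (2 * k) e x"
      by blast
    have "(\<Sum>i\<in>UNIV. (x $ i)\<^sup>2) ^ Suc k
        = hpoly (2 * Suc k) (\<lambda>\<alpha>. \<Sum>i\<in>UNIV. shift_coeffs i (shift_coeffs i e) \<alpha>) x" for x :: "real^'n"
      by (simp add: e[symmetric] hpoly_sum hpoly_shift sum_distrib_right power2_eq_square mult.assoc)
    then show ?case by blast
  qed
  then show thesis using that by blast
qed

lemma DERIV_sum_squares_axis:
  fixes x :: "real^'n"
  shows "((\<lambda>t. \<Sum>l\<in>UNIV. ((x + t *\<^sub>R axis i 1) $ l)\<^sup>2) has_real_derivative 2 * x $ i) (at 0)"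
proof -
  have "((\<lambda>t. \<Sum>l\<in>UNIV. (x $ l + t * axis i 1 $ l)\<^sup>2) has_real_derivative
      (\<Sum>l\<in>UNIV. 2 * x $ l * axis i 1 $ l)) (at 0)"
    by (auto intro!: derivative_eq_intros sum.cong)
  moreover have "(\<Sum>l\<in>UNIV. 2 * x $ l * axis i 1 $ l) = 2 * x $ i"
    by (simp add: axis_def if_distrib[of "\<lambda>t. _ * t"] cong: if_cong)
  ultimately show ?thesis by simp
qed

text \<open>The explicit formula serves both directions: the first term is positive for nonzero
  \<open>x\<close> and \<open>y\<close>, the second is nonnegative, and both are bounded on unit
  vectors. At \<open>k = 0\<close> the truncated \<open>k - 1\<close> comes with the factor
  \<open>k\<close>.\<close>

lemma hessian_sum_squares_power:
  fixes x y :: "real^'n" and s :: "real^'n \<Rightarrow> real"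
  defines "s \<equiv> \<lambda>x::real^'n. \<Sum>i\<in>UNIV. (x $ i)\<^sup>2"
  shows "y \<bullet> (hessian (\<lambda>x. s x ^ Suc k) x *v y)
    = 2 * Suc k * s x ^ k * (norm y)\<^sup>2 + 4 * Suc k * k * s x ^ (k - 1) * (x \<bullet> y)\<^sup>2"
proof -
  have s: "((\<lambda>t. s (x + t *\<^sub>R axis i 1)) has_real_derivative 2 * x $ i) (at 0)" for i x
    unfolding s_def by (rule DERIV_sum_squares_axis)
  have first: "partial j (\<lambda>x. s x ^ Suc k) = (\<lambda>x. 2 * Suc k * (s x ^ k * x $ j))" for j
  proof
    fix x
    have "((\<lambda>t. s (x + t *\<^sub>R axis j 1) ^ Suc k) has_real_derivative 2 * Suc k * (s x ^ k * x $ j)) (at 0)"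
      using DERIV_power[OF s, of x j "Suc k"] by (simp add: algebra_simps del: power_Suc)
    then show "partial j (\<lambda>x. s x ^ Suc k) x = 2 * Suc k * (s x ^ k * x $ j)"
      unfolding partial_def by (rule DERIV_imp_deriv)
  qed
  have second: "hessian (\<lambda>x. s x ^ Suc k) x $ i $ j
      = 2 * Suc k * (s x ^ k * (if i = j then 1 else 0))
        + 4 * Suc k * k * s x ^ (k - 1) * (x $ i * x $ j)" for i j
  proof -
    have "((\<lambda>t. (x + t *\<^sub>R axis i 1) $ j) has_real_derivative (if i = j then 1 else 0)) (at 0)"
      by (auto simp: axis_def intro!: derivative_eq_intros)
    from DERIV_mult[OF DERIV_power[OF s, of x i k] this]
    have "((\<lambda>t. s (x + t *\<^sub>R axis i 1) ^ k * (x + t *\<^sub>R axis i 1) $ j) has_real_derivative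
        s x ^ k * (if i = j then 1 else 0)
        + 2 * k * s x ^ (k - 1) * (x $ i * x $ j)) (at 0)"
      by (simp add: mult_ac add.commute)
    from DERIV_cmult[OF this, of "2 * Suc k"] show ?thesis
      unfolding hessian_def first by (simp add: partial_def DERIV_imp_deriv algebra_simps)
  qed
  have "y \<bullet> (hessian (\<lambda>x. s x ^ Suc k) x *v y)
      = 2 * Suc k * s x ^ k * (\<Sum>i\<in>UNIV. \<Sum>j\<in>UNIV. if i = j then y $ i * y $ j else 0)
        + 4 * Suc k * k * s x ^ (k - 1) * (\<Sum>i\<in>UNIV. \<Sum>j\<in>UNIV. (x $ i * y $ i) * (x $ j * y $ j))"
    unfolding quadratic_form_eq_sum second sum_distrib_left sum.distrib[symmetric]
    by (intro sum.cong refl) (simp add: algebra_simps)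
  also have "(\<Sum>i\<in>UNIV. \<Sum>j\<in>UNIV. if i = j then y $ i * y $ j else 0) = (norm y)\<^sup>2"
    by (simp add: power2_norm_eq_inner inner_vec_def)
  also have "(\<Sum>i\<in>UNIV. \<Sum>j\<in>UNIV. (x $ i * y $ i) * (x $ j * y $ j)) = (x \<bullet> y)\<^sup>2"
    by (simp add: power2_eq_square sum_product inner_vec_def)
  finally show ?thesis .
qed

lemma is_sos2_nonneg: "is_sos2 p \<Longrightarrow> 0 \<le> p x y"
  unfolding is_sos2_def by (auto intro!: sum_list_nonneg)

section \<open>Positive biforms\<close>

definition biform :: "nat \<Rightarrow> ('n \<Rightarrow> 'n \<Rightarrow> ('n::finite \<Rightarrow> nat) \<Rightarrow> real) \<Rightarrow> real^'n \<Rightarrow> real^'n \<Rightarrow> real" where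
  "biform m P x y = (\<Sum>i\<in>UNIV. \<Sum>j\<in>UNIV. y $ i * y $ j * hpoly m (P i j) x)"

lemma biform_scaleR: "biform m P (t *\<^sub>R x) (r *\<^sub>R y) = t ^ m * r\<^sup>2 * biform m P x y"
  by (simp add: biform_def hpoly_scaleR sum_distrib_left power2_eq_square mult_ac)

lemma continuous_on_biform:
  fixes P :: "'n \<Rightarrow> 'n \<Rightarrow> ('n::finite \<Rightarrow> nat) \<Rightarrow> real"
  shows "continuous_on S (\<lambda>z. biform m P (fst z) (snd z))"
  unfolding biform_def hpoly_def monomial_fun_def by (intro continuous_intros)

text \<open>Polar decomposition that also covers the zero vector, where any unit vector will do; it
  reduces biforms to unit arguments.\<close>

lemma norm_scaleR_unit_exists:
  fixes x :: "real^'n"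
  shows "\<exists>e. norm e = 1 \<and> norm x *\<^sub>R e = x"
proof (cases "x = 0")
  case True
  then show ?thesis by (intro exI[of _ "axis undefined 1"]) simp
next
  case False
  then show ?thesis by (intro exI[of _ "x /\<^sub>R norm x"]) simp
qed

lemma biform_nonnegI:
  assumes "\<And>x y. norm x = 1 \<Longrightarrow> norm y = 1 \<Longrightarrow> 0 \<le> biform m P x y"
  shows "0 \<le> biform m P x y"
proof -
  obtain e where e: "norm e = 1" "norm x *\<^sub>R e = x" using norm_scaleR_unit_exists by blast
  obtain e' where e': "norm e' = 1" "norm y *\<^sub>R e' = y" using norm_scaleR_unit_exists by blast
  have "biform m P x y = norm x ^ m * (norm y)\<^sup>2 * biform m P e e'"
    using biform_scaleR[of m P "norm x" e "norm y" e'] unfolding e e' .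
  then show ?thesis using assms[OF e(1) e'(1)] by simp
qed

text \<open>A continuous function attains its minimum on the compact product of two unit
  spheres.\<close>

lemma biform_pos_lower_bound:
  fixes P :: "'n \<Rightarrow> 'n \<Rightarrow> ('n::finite \<Rightarrow> nat) \<Rightarrow> real"
  assumes "\<And>x y. norm x = 1 \<Longrightarrow> norm y = 1 \<Longrightarrow> 0 < biform m P x y"
  shows "\<exists>\<delta>>0. \<forall>x y. norm x = 1 \<longrightarrow> norm y = 1 \<longrightarrow> \<delta> \<le> biform m P x y"
proof -
  let ?S = "sphere 0 1 \<times> sphere 0 1 :: ((real^'n) \<times> (real^'n)) set"
  have "(axis undefined 1, axis undefined 1) \<in> ?S" by simp
  then have ne: "?S \<noteq> {}" by blast
  have "compact ?S" by (intro compact_Times compact_sphere)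
  from continuous_attains_inf[OF this ne continuous_on_biform[of ?S m P]]
  obtain z where z: "z \<in> ?S"
    "\<forall>w\<in>?S. biform m P (fst z) (snd z) \<le> biform m P (fst w) (snd w)" ..
  show ?thesis
  proof (intro exI[of _ "biform m P (fst z) (snd z)"] conjI allI impI)
    show "0 < biform m P (fst z) (snd z)" using z(1) by (cases z) (auto intro!: assms)
    fix x y :: "real^'n"
    assume "norm x = 1" "norm y = 1"
    then show "biform m P (fst z) (snd z) \<le> biform m P x y" using bspec[OF z(2), of "(x, y)"] by simp
  qed
qed

lemma abs_monomial_fun_le_1: "norm x = 1 \<Longrightarrow> \<bar>monomial_fun \<alpha> x\<bar> \<le> 1"
  unfolding monomial_fun_def abs_prod power_abs
  using component_le_norm_cart[of x] by (intro prod_le_1) (auto intro!: power_le_one)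

text \<open>Coefficientwise convergence is uniform on unit vectors, and a positive biform has a
  positive minimum there; homogeneity extends nonnegativity to all arguments.\<close>

lemma eventually_biform_nonneg:
  fixes P :: "'n \<Rightarrow> 'n \<Rightarrow> ('n::finite \<Rightarrow> nat) \<Rightarrow> real"
  assumes pos: "\<And>x y. norm x = 1 \<Longrightarrow> norm y = 1 \<Longrightarrow> 0 < biform m P x y"
    and lim: "\<And>i j \<beta>. \<beta> \<in> multi_indices m \<Longrightarrow> (\<lambda>K. Q K i j \<beta>) \<longlonglongrightarrow> P i j \<beta>"
  shows "eventually (\<lambda>K. \<forall>x y. 0 \<le> biform m (Q K) x y) sequentially"
proof -
  obtain \<delta> where \<delta>: "0 < \<delta>" "\<And>x y. norm x = 1 \<Longrightarrow> norm y = 1 \<Longrightarrow> \<delta> \<le> biform m P x y"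
    using biform_pos_lower_bound[OF pos] by blast
  \<comment> \<open>The sum of all coefficient differences bounds the difference of the biforms on
    unit vectors, where monomials and coordinates are at most 1 in absolute value.\<close>
  define D where "D K = (\<Sum>i\<in>UNIV. \<Sum>j\<in>UNIV. \<Sum>\<beta>\<in>multi_indices m. \<bar>Q K i j \<beta> - P i j \<beta>\<bar>)" for K
  have "D \<longlonglongrightarrow> (\<Sum>i\<in>(UNIV::'n set). \<Sum>j\<in>(UNIV::'n set). \<Sum>\<beta>\<in>multi_indices m. \<bar>P i j \<beta> - P i j \<beta>\<bar>)"
    unfolding D_def by (intro tendsto_sum tendsto_rabs tendsto_diff tendsto_const lim)
  then have "D \<longlonglongrightarrow> 0" by simp
  then have "eventually (\<lambda>K. D K < \<delta>) sequentially"
    using \<delta>(1) by (rule order_tendstoD)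
  then show ?thesis
  proof (rule eventually_mono)
    fix K assume K: "D K < \<delta>"
    have "0 \<le> biform m (Q K) x y" if xy: "norm x = 1" "norm y = 1" for x y
    proof -
      have "\<bar>biform m (Q K) x y - biform m P x y\<bar>
          = \<bar>\<Sum>i\<in>UNIV. \<Sum>j\<in>UNIV. \<Sum>\<beta>\<in>multi_indices m.
              (Q K i j \<beta> - P i j \<beta>) * (y $ i * y $ j * monomial_fun \<beta> x)\<bar>"
        unfolding biform_def hpoly_def sum_subtractf[symmetric] sum_distrib_left
        by (simp add: algebra_simps)
      also have "\<dots> \<le> D K"
        unfolding D_def
      proof (intro order_trans[OF sum_abs] sum_mono)
        fix i j \<beta>
        have "\<bar>y $ i\<bar> * \<bar>y $ j\<bar> * \<bar>monomial_fun \<beta> x\<bar> \<le> 1 * 1 * 1"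
          using xy component_le_norm_cart[of y] abs_monomial_fun_le_1[of x \<beta>]
          by (intro mult_mono) auto
        then show "\<bar>(Q K i j \<beta> - P i j \<beta>) * (y $ i * y $ j * monomial_fun \<beta> x)\<bar>
            \<le> \<bar>Q K i j \<beta> - P i j \<beta>\<bar>"
          by (simp add: abs_mult mult_left_le)
      qed
      finally show ?thesis using K \<delta>(2)[OF xy] by linarith
    qed
    then show "\<forall>x y. 0 \<le> biform m (Q K) x y" using biform_nonnegI by blast
  qed
qed

text \<open>Applies the inverse Gaussian operator to every entry of \<open>P\<close>. For large
  \<open>K\<close> the preimage matrix is still positive semidefinite, so its Gaussian image, which
  is \<open>P\<close> times a power of the norm, is a sum of squares.\<close>

lemma positive_biform_times_norm_power_sos:
  fixes P :: "'n \<Rightarrow> 'n \<Rightarrow> ('n::finite \<Rightarrow> nat) \<Rightarrow> real"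
  assumes pos: "\<And>x y. norm x = 1 \<Longrightarrow> norm y = 1 \<Longrightarrow> 0 < biform (2 * k) P x y"
  obtains r where "is_sos2 (\<lambda>x y. biform (2 * k) P x y * (\<Sum>i\<in>UNIV. (x $ i)\<^sup>2) ^ r)"
proof -
  let ?m = "2 * k"
  have "\<forall>i j. \<exists>c. (\<forall>\<beta>\<in>multi_indices ?m. (\<lambda>K. c K \<beta>) \<longlonglongrightarrow> P i j \<beta>) \<and>
    (\<forall>K\<ge>?m. \<forall>x::real^'n. gauss_power K x (hpoly ?m (c K))
      = fact K / fact (K - ?m) * std_normal_moment (K - ?m) * norm x ^ (K - ?m) * hpoly ?m (P i j) x)"
    using gauss_power_preimage by blast
  then obtain c where
    lim: "\<And>i j \<beta>. \<beta> \<in> multi_indices ?m \<Longrightarrow> (\<lambda>K. c i j K \<beta>) \<longlonglongrightarrow> P i j \<beta>"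
    and c: "\<And>i j K x. K \<ge> ?m \<Longrightarrow> gauss_power K x (hpoly ?m (c i j K))
      = fact K / fact (K - ?m) * std_normal_moment (K - ?m) * norm x ^ (K - ?m) * hpoly ?m (P i j) x"
    by metis
  have "eventually (\<lambda>K. \<forall>x y. 0 \<le> biform ?m (\<lambda>i j. c i j K) x y) sequentially"
    by (rule eventually_biform_nonneg[OF pos lim])
  then obtain L where L: "\<And>K x y. K \<ge> L \<Longrightarrow> 0 \<le> biform ?m (\<lambda>i j. c i j K) x y"
    unfolding eventually_sequentially by blast
  \<comment> \<open>With \<open>K = 2 * N\<close> the exponent is even and at least
    \<open>L\<close>, and \<open>K - 2 * k = 2 * L\<close>, so the remaining norm power is the
    \<open>L\<close>-th power of the sum of squares.\<close>
  define N where "N = L + k"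
  \<comment> \<open>The factor picked up by the preimages at \<open>K = 2 * N\<close>; it is
    positive because even Gaussian moments are.\<close>
  define \<kappa> :: real where "\<kappa> = fact (2 * N) / fact (2 * L) * std_normal_moment (2 * L)"
  have \<kappa>: "0 < \<kappa>" by (simp add: \<kappa>_def std_normal_moment_double)
  define Q where "Q i j \<beta> = 1 / \<kappa> * c i j (2 * N) \<beta>" for i j \<beta>
  have Q: "hpoly ?m (Q i j) u = 1 / \<kappa> * hpoly ?m (c i j (2 * N)) u" for i j u
    unfolding Q_def by (rule hpoly_cmult)
  have norm: "norm x ^ (2 * L) = (\<Sum>i\<in>UNIV. (x $ i)\<^sup>2) ^ L" for x :: "real^'n"
    unfolding power_mult power2_norm_eq_inner by (simp add: inner_vec_def power2_eq_square)
  have gQ: "gauss_power (2 * N) x (hpoly ?m (Q i j)) = (\<Sum>i\<in>UNIV. (x $ i)\<^sup>2) ^ L * hpoly ?m (P i j) x"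
    for i j x
  proof -
    have "hpoly ?m (Q i j) = (\<lambda>u. 1 / \<kappa> * hpoly ?m (c i j (2 * N)) u)"
      by (rule ext) (rule Q)
    then have "gauss_power (2 * N) x (hpoly ?m (Q i j))
        = 1 / \<kappa> * gauss_power (2 * N) x (hpoly ?m (c i j (2 * N)))"
      by (simp only: gauss_power_cmult)
    also have "\<dots> = 1 / \<kappa> * (\<kappa> * norm x ^ (2 * L) * hpoly ?m (P i j) x)"
      by (subst c) (simp_all add: \<kappa>_def N_def)
    also have "\<dots> = (\<Sum>i\<in>UNIV. (x $ i)\<^sup>2) ^ L * hpoly ?m (P i j) x"
      using \<kappa> by (simp add: norm)
    finally show ?thesis .
  qed
  have "is_sos2 (\<lambda>x y. \<Sum>i\<in>UNIV. \<Sum>j\<in>UNIV. y $ i * y $ j * gauss_power (2 * N) x (hpoly ?m (Q i j)))"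
  proof (rule is_sos2_gauss_power)
    fix u y :: "real^'n"
    have "(\<Sum>i\<in>UNIV. \<Sum>j\<in>UNIV. y $ i * y $ j * hpoly ?m (Q i j) u)
        = 1 / \<kappa> * biform ?m (\<lambda>i j. c i j (2 * N)) u y"
      unfolding Q biform_def sum_distrib_left by (simp add: mult_ac)
    then show "0 \<le> (\<Sum>i\<in>UNIV. \<Sum>j\<in>UNIV. y $ i * y $ j * hpoly ?m (Q i j) u)"
      using L[of "2 * N" u y] \<kappa> by (simp add: N_def)
  qed
  then have "is_sos2 (\<lambda>x y. biform ?m P x y * (\<Sum>i\<in>UNIV. (x $ i)\<^sup>2) ^ L)"
    unfolding gQ biform_def by (simp add: sum_distrib_left sum_distrib_right mult_ac)
  then show thesis by (rule that)
qed

section \<open>Positive definite Hessians and r-sos-convexity\<close>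

theorem theorem7:
  fixes f :: "real^'n \<Rightarrow> real" and d :: nat
  assumes "CARD('n) \<ge> 2"
    and "d \<ge> 2" and "even d"
    and "is_form d f"
  shows "(\<forall>x. x \<noteq> 0 \<longrightarrow> pos_def (hessian f x)) \<longleftrightarrow>
         (\<exists>c::real. c > 0 \<and> (\<exists>r::nat.
            r_sos_convex r (\<lambda>x. f x - c * (\<Sum>i\<in>UNIV. (x $ i)\<^sup>2) ^ (d div 2))))"
proof -
  obtain j where j: "d = 2 * j" using assms(3) by (rule evenE)
  \<comment> \<open>Writing \<open>d\<close> as \<open>2 * Suc k\<close> makes the Hessian entries
    forms of even degree \<open>2 * k\<close>.\<close>
  then obtain k where d: "d = 2 * Suc k" using assms(2) by (cases j) auto
  then have d': "d = Suc (Suc (2 * k))" and half: "d div 2 = Suc k" by simp_all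
  obtain a where f: "f = hpoly d a" using is_form_imp_hpoly[OF assms(4)] by blast
  let ?s = "\<lambda>x::real^'n. \<Sum>i\<in>UNIV. (x $ i)\<^sup>2"
  obtain e where e: "(\<lambda>x. ?s x ^ Suc k) = hpoly d e"
    using sum_squares_power_eq_hpoly[of "Suc k"] unfolding d by blast
  define H where "H b i j = deriv_coeffs i (deriv_coeffs j b)" for b :: "('n \<Rightarrow> nat) \<Rightarrow> real" and i j
  have quad: "y \<bullet> (hessian (hpoly d b) x *v y) = biform (2 * k) (H b) x y" for b x and y :: "real^'n"
    by (simp add: quadratic_form_eq_sum biform_def d' hessian_hpoly H_def)
  have s_norm: "?s x = (norm x)\<^sup>2" for x
    unfolding power2_norm_eq_inner by (simp add: inner_vec_def power2_eq_square)
  have e_eq: "biform (2 * k) (H e) x y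
      = 2 * Suc k * ?s x ^ k * (norm y)\<^sup>2 + 4 * Suc k * k * ?s x ^ (k - 1) * (x \<bullet> y)\<^sup>2" for x y
    using hessian_sum_squares_power[of y k x] unfolding e quad by simp
  have g: "(\<lambda>x. f x - c * ?s x ^ (d div 2)) = hpoly d (\<lambda>\<alpha>. a \<alpha> - c * e \<alpha>)" for c
    using fun_cong[OF e] by (simp add: fun_eq_iff hpoly_diff hpoly_cmult f half)
  have Hg: "biform (2 * k) (H (\<lambda>\<alpha>. a \<alpha> - c * e \<alpha>)) x y
      = biform (2 * k) (H a) x y - c * biform (2 * k) (H e) x y" for c x y
  proof -
    have "H (\<lambda>\<alpha>. a \<alpha> - c * e \<alpha>) i j = (\<lambda>\<alpha>. H a i j \<alpha> - c * H e i j \<alpha>)" for i j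
      by (simp add: H_def deriv_coeffs_def fun_eq_iff algebra_simps)
    then show ?thesis
      by (simp add: biform_def hpoly_diff hpoly_cmult sum_subtractf sum_distrib_left algebra_simps)
  qed
  have sos: "r_sos_convex r (\<lambda>x. f x - c * ?s x ^ (d div 2))
      \<longleftrightarrow> is_sos2 (\<lambda>x y. biform (2 * k) (H (\<lambda>\<alpha>. a \<alpha> - c * e \<alpha>)) x y * ?s x ^ r)" for r c
    unfolding r_sos_convex_def g quad ..
  have pd: "pos_def (hessian f x) \<longleftrightarrow> (\<forall>y. y \<noteq> 0 \<longrightarrow> 0 < biform (2 * k) (H a) x y)" for x
    unfolding pos_def_def f quad ..
  show ?thesis
  proof
    assume pos: "\<forall>x. x \<noteq> 0 \<longrightarrow> pos_def (hessian f x)"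
    have Ha: "0 < biform (2 * k) (H a) x y" if "norm x = 1" "norm y = 1" for x y
    proof -
      have "x \<noteq> 0" "y \<noteq> 0" using that by auto
      then show ?thesis using pos unfolding pd by blast
    qed
    obtain \<delta> where \<delta>: "0 < \<delta>"
      "\<And>x y. norm x = 1 \<Longrightarrow> norm y = 1 \<Longrightarrow> \<delta> \<le> biform (2 * k) (H a) x y"
      using biform_pos_lower_bound[OF Ha] by blast
    \<comment> \<open>An upper bound on unit vectors for the biform of the Hessian of the norm
      power, from \<open>e_eq\<close> and Cauchy-Schwarz.\<close>
    define B where "B = real (2 * Suc k) + real (4 * Suc k * k)"
    have B: "0 < B" by (simp add: B_def del: of_nat_mult)
    \<comment> \<open>Subtracting \<open>c\<close> times that biform costs at most half of the lower
      bound \<open>\<delta>\<close>.\<close>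
    define c where "c = \<delta> / (2 * B)"
    have c: "0 < c" using \<delta>(1) B by (simp add: c_def)
    have pos_g: "0 < biform (2 * k) (H (\<lambda>\<alpha>. a \<alpha> - c * e \<alpha>)) x y" if xy: "norm x = 1" "norm y = 1" for x y
    proof -
      have "\<bar>x \<bullet> y\<bar> \<le> 1" using Cauchy_Schwarz_ineq2[of x y] xy by simp
      then have "(x \<bullet> y)\<^sup>2 \<le> 1" by (simp add: abs_square_le_1)
      then have "real (4 * Suc k * k) * (x \<bullet> y)\<^sup>2 \<le> real (4 * Suc k * k)"
        by (rule mult_left_le) simp
      then have "biform (2 * k) (H e) x y \<le> B"
        unfolding e_eq s_norm xy B_def by (simp only: power_one mult_1_right add_left_mono)
      then have "c * biform (2 * k) (H e) x y \<le> c * B"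
        using c by (intro mult_left_mono) auto
      also have "c * B = \<delta> / 2" using B by (simp add: c_def)
      finally show ?thesis using \<delta> \<delta>(2)[OF xy] unfolding Hg by linarith
    qed
    obtain r where "is_sos2 (\<lambda>x y. biform (2 * k) (H (\<lambda>\<alpha>. a \<alpha> - c * e \<alpha>)) x y * ?s x ^ r)"
      by (rule positive_biform_times_norm_power_sos[OF pos_g])
    then show "\<exists>c>0. \<exists>r. r_sos_convex r (\<lambda>x. f x - c * ?s x ^ (d div 2))"
      unfolding sos using c by blast
  next
    assume "\<exists>c>0. \<exists>r. r_sos_convex r (\<lambda>x. f x - c * ?s x ^ (d div 2))"
    then obtain c r where c: "0 < c"
      and r: "is_sos2 (\<lambda>x y. biform (2 * k) (H (\<lambda>\<alpha>. a \<alpha> - c * e \<alpha>)) x y * ?s x ^ r)"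
      unfolding sos by blast
    \<comment> \<open>Dividing the sum of squares by the positive norm power shows that the biform
      of the difference is nonnegative; adding back \<open>c\<close> times the positive biform of
      the norm power gives strictness.\<close>
    have "0 < biform (2 * k) (H a) x y" if xy: "x \<noteq> 0" "y \<noteq> 0" for x y
    proof -
      have s: "0 < ?s x" using xy unfolding s_norm by simp
      have "0 \<le> biform (2 * k) (H (\<lambda>\<alpha>. a \<alpha> - c * e \<alpha>)) x y"
        using is_sos2_nonneg[OF r, of x y] zero_less_power[OF s, of r]
        by (simp add: zero_le_mult_iff)
      moreover have "0 < c * biform (2 * k) (H e) x y"
      proof (rule mult_pos_pos[OF c])
        have "0 < real (2 * Suc k) * ?s x ^ k * (norm y)\<^sup>2" using s xy by simp
        moreover have "0 \<le> real (4 * Suc k * k) * ?s x ^ (k - 1) * (x \<bullet> y)\<^sup>2"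
          using s by (intro mult_nonneg_nonneg zero_le_power2 zero_le_power) simp_all
        ultimately show "0 < biform (2 * k) (H e) x y" unfolding e_eq by linarith
      qed
      ultimately show ?thesis unfolding Hg by linarith
    qed
    then show "\<forall>x. x \<noteq> 0 \<longrightarrow> pos_def (hessian f x)" unfolding pd by blast
  qed
qed

end
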